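(* Let $\Gamma,\Delta$ be countable groups, let $b_0$ be a measure preserving, ergodic action of $\Gamma$ on a standard probability space $(X,\mu)$ with induced equivalence relation $F=E^X_\Gamma$, and let $a_0$ be a free, measure preserving action of $\Delta$ on $(X,\mu)$ with induced equivalence relation $E=E^X_\Delta\subseteq F$. If $b_0$ is mixing, the following are equivalent: (i) for all measure preserving actions $a$ of $\Delta$ (on a standard probability space), the co-induced action $b=\mathrm{CInd}(a_0,b_0)^\Gamma_\Delta(a)$ is mixing; (ii) $\varphi_E(\gamma)\to 0$ as $\gamma\to\infty$ in $\Gamma$.
   Context: Standard probability space: isomorphic to $[0,1]$ with Lebesgue measure; everything is modulo null sets. $E^X_\Gamma$ denotes the orbit equivalence relation of an action of $\Gamma$ on $X$. $\varphi_E(\gamma)=\mu(\{x:\gamma\cdot x\,E\,x\})$, where $\gamma\cdot x$ is the action $b_0$. A measure preserving action of $\Gamma$ on $(Z,\rho)$ is mixing if $\rho(\gamma\cdot A\cap B)\to\rho(A)\rho(B)$ as $\gamma\to\infty$ for all Borel $A,B\subseteq Z$. Here "$f(\gamma)\to c$ as $\gamma\to\infty$" means that for every $\epsilon>0$, $|f(\gamma)-c|<\epsilon$ for all but finitely many $\gamma$. Co-induced action. By ergodicity there is $N\in\{1,2,\dots,\aleph_0\}$ such that every $F$-class contains exactly $N$ $E$-classes; identify $N$ with $\{0,\dots,N-1\}$ if finite and with $\mathbb N$ if $N=\aleph_0$. Fix Borel choice functions $C_n:X\to X$ ($n\in N$) with $C_0=\mathrm{id}$ such that for each $x$ the points $C_n(x)$,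 $n\in N$, are distinct and form a transversal for the $E$-classes contained in $[x]_F$ (if $a_0$ is ergodic, the $C_n$ are taken to be one-to-one, which is possible). For $\gamma\in\Gamma$, $x\in X$ let $\pi(\gamma,x)$ be the permutation of $N$ defined by $\pi(\gamma,x)(k)=n\Leftrightarrow [C_k(x)]_E=[C_n(\gamma\cdot x)]_E$, and for $n\in N$ let $\bar\delta(\gamma,x)_n$ be the unique element of $\Delta$ with $\bar\delta(\gamma,x)_n\cdot C_{\pi(\gamma,x)^{-1}(n)}(x)=C_n(\gamma\cdot x)$ (action $a_0$). Given a measure preserving action $a$ of $\Delta$ on a standard probability space $(Y,\nu)$, $\mathrm{CInd}(a_0,b_0)^\Gamma_\Delta(a)$ is the measure preserving action of $\Gamma$ on $(X\times Y^N,\mu\times\nu^N)$ given by $\gamma\cdot(x,\bar y)=(\gamma\cdot x,\ (n\mapsto \bar\delta(\gamma,x)_n\cdot \bar y_{\pi(\gamma,x)^{-1}(n)}))$, where $\Delta$ acts on $Y$ by $a$. Up to isomorphism it does not depend on the choice functions. *)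

theory Defs
  imports "HOL-Analysis.Analysis" "HOL-Algebra.Group_Action"
begin

text \<open>Every nonatomic Borel probability measure on a standard Borel space is isomorphic to
  Lebesgue measure on the Borel subsets of the unit interval by a bijection defined everywhere,
  so no null sets are discarded in the isomorphism.\<close>

definition standard_prob_space :: "'a measure \<Rightarrow> bool" where
  "standard_prob_space M \<longleftrightarrow>
     (\<exists>f g. f \<in> M \<rightarrow>\<^sub>M restrict_space lborel {0..1::real} \<and>
            g \<in> restrict_space lborel {0..1::real} \<rightarrow>\<^sub>M M \<and>
            (\<forall>x\<in>space M. g (f x) = x) \<and> (\<forall>t\<in>{0..1}. f (g t) = t) \<and>
            distr M (restrict_space lborel {0..1}) f = restrict_space lborel {0..1})"

definition mp_action ::
    "('g, 'm) monoid_scheme \<Rightarrow> 'a measure \<Rightarrow> ('g \<Rightarrow> 'a \<Rightarrow> 'a) \<Rightarrow> bool" where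
  "mp_action G M a \<longleftrightarrow>
     group_action G (space M) a \<and>
     (\<forall>g\<in>carrier G. a g \<in> M \<rightarrow>\<^sub>M M \<and> distr M M (a g) = M)"

definition orbit_rel ::
    "('g, 'm) monoid_scheme \<Rightarrow> 'a measure \<Rightarrow> ('g \<Rightarrow> 'a \<Rightarrow> 'a) \<Rightarrow> 'a rel" where
  "orbit_rel G M a = {(x, y). x \<in> space M \<and> y \<in> orbit G a x}"

definition ergodic ::
    "('g, 'm) monoid_scheme \<Rightarrow> 'a measure \<Rightarrow> ('g \<Rightarrow> 'a \<Rightarrow> 'a) \<Rightarrow> bool" where
  "ergodic G M a \<longleftrightarrow>
     (\<forall>A\<in>sets M. (\<forall>g\<in>carrier G. a g ` A = A) \<longrightarrow> measure M A = 0 \<or> measure M A = 1)"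

definition free_at :: "('g, 'm) monoid_scheme \<Rightarrow> ('g \<Rightarrow> 'a \<Rightarrow> 'a) \<Rightarrow> 'a \<Rightarrow> bool" where
  "free_at G a x \<longleftrightarrow> (\<forall>g\<in>carrier G. a g x = x \<longrightarrow> g = \<one>\<^bsub>G\<^esub>)"

definition free_action ::
    "('g, 'm) monoid_scheme \<Rightarrow> 'a measure \<Rightarrow> ('g \<Rightarrow> 'a \<Rightarrow> 'a) \<Rightarrow> bool" where
  "free_action G M a \<longleftrightarrow> (AE x in M. free_at G a x)"

text \<open>The filter of \<open>g \<rightarrow> \<infinity>\<close> in \<open>G\<close>: a property holds eventually iff it holds for all but
  finitely many elements of the carrier. It is trivial when \<open>G\<close> is finite.\<close>

definition group_infinity :: "('g, 'm) monoid_scheme \<Rightarrow> 'g filter" where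
  "group_infinity G = inf cofinite (principal (carrier G))"

lemma tendsto_group_infinity_iff:
  "(f \<longlongrightarrow> (c::real)) (group_infinity G) \<longleftrightarrow>
     (\<forall>e>0. finite {g \<in> carrier G. \<not> \<bar>f g - c\<bar> < e})"
proof -
  have "eventually P (group_infinity G) \<longleftrightarrow> finite {g \<in> carrier G. \<not> P g}" for P
    unfolding group_infinity_def eventually_inf_principal eventually_cofinite
    by (rule arg_cong[where f = finite]) auto
  then show ?thesis
    by (simp add: tendsto_iff dist_real_def)
qed

definition mixing ::
    "('g, 'm) monoid_scheme \<Rightarrow> 'a measure \<Rightarrow> ('g \<Rightarrow> 'a \<Rightarrow> 'a) \<Rightarrow> bool" where
  "mixing G M a \<longleftrightarrow>
     (\<forall>A\<in>sets M. \<forall>B\<in>sets M.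
        ((\<lambda>g. measure M (a g ` A \<inter> B)) \<longlongrightarrow> measure M A * measure M B) (group_infinity G))"

definition return_measure ::
    "'a measure \<Rightarrow> 'a rel \<Rightarrow> ('g \<Rightarrow> 'a \<Rightarrow> 'a) \<Rightarrow> 'g \<Rightarrow> real" where
  "return_measure M E b g = measure M {x \<in> space M. (b g x, x) \<in> E}"

definition index_set :: "enat \<Rightarrow> nat set" where
  "index_set N = {n. enat n < N}"

definition choice_at ::
    "'a rel \<Rightarrow> 'a rel \<Rightarrow> enat \<Rightarrow> (nat \<Rightarrow> 'a \<Rightarrow> 'a) \<Rightarrow> 'a \<Rightarrow> bool" where
  "choice_at F E N C x \<longleftrightarrow>
     C 0 x = x \<and>
     inj_on (\<lambda>n. C n x) (index_set N) \<and>
     (\<lambda>n. C n x) ` index_set N \<subseteq> F `` {x} \<and>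
     (\<forall>y\<in>F `` {x}. \<exists>!z. z \<in> (\<lambda>n. C n x) ` index_set N \<and> (z, y) \<in> E)"

definition choice_functions ::
    "'a measure \<Rightarrow> 'a rel \<Rightarrow> 'a rel \<Rightarrow> enat \<Rightarrow> (nat \<Rightarrow> 'a \<Rightarrow> 'a) \<Rightarrow> bool" where
  "choice_functions X F E N C \<longleftrightarrow>
     1 \<le> N \<and>
     (\<forall>n\<in>index_set N. C n \<in> X \<rightarrow>\<^sub>M X) \<and>
     (AE x in X. choice_at F E N C x)"

definition coind_perm ::
    "'x rel \<Rightarrow> enat \<Rightarrow> (nat \<Rightarrow> 'x \<Rightarrow> 'x) \<Rightarrow> ('g \<Rightarrow> 'x \<Rightarrow> 'x) \<Rightarrow> 'g \<Rightarrow> 'x \<Rightarrow> nat \<Rightarrow> nat" where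
  "coind_perm E N C b0 g x k =
     (THE n. n \<in> index_set N \<and> E `` {C k x} = E `` {C n (b0 g x)})"

definition coind_perm_inv ::
    "'x rel \<Rightarrow> enat \<Rightarrow> (nat \<Rightarrow> 'x \<Rightarrow> 'x) \<Rightarrow> ('g \<Rightarrow> 'x \<Rightarrow> 'x) \<Rightarrow> 'g \<Rightarrow> 'x \<Rightarrow> nat \<Rightarrow> nat" where
  "coind_perm_inv E N C b0 g x = the_inv_into (index_set N) (coind_perm E N C b0 g x)"

definition coind_delta ::
    "('d, 'n) monoid_scheme \<Rightarrow> ('d \<Rightarrow> 'x \<Rightarrow> 'x) \<Rightarrow> 'x rel \<Rightarrow> enat \<Rightarrow> (nat \<Rightarrow> 'x \<Rightarrow> 'x) \<Rightarrow>
     ('g \<Rightarrow> 'x \<Rightarrow> 'x) \<Rightarrow> 'g \<Rightarrow> 'x \<Rightarrow> nat \<Rightarrow> 'd" where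
  "coind_delta D a0 E N C b0 g x n =
     (THE d. d \<in> carrier D \<and> a0 d (C (coind_perm_inv E N C b0 g x n) x) = C n (b0 g x))"

text \<open>The permutation and the group elements above are meaningful when freeness and the
  transversal property hold on the whole \<open>F\<close>-class of \<open>x\<close>. These points form an invariant set,
  conull under the standing assumptions; on its complement the action is the trivial extension
  of \<open>b0\<close>, so that one gets an action that is defined everywhere.\<close>

definition coinduced ::
    "('g, 'm) monoid_scheme \<Rightarrow> ('d, 'n) monoid_scheme \<Rightarrow> 'x measure \<Rightarrow>
     ('d \<Rightarrow> 'x \<Rightarrow> 'x) \<Rightarrow> ('g \<Rightarrow> 'x \<Rightarrow> 'x) \<Rightarrow> enat \<Rightarrow> (nat \<Rightarrow> 'x \<Rightarrow> 'x) \<Rightarrow>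
     ('d \<Rightarrow> 'y \<Rightarrow> 'y) \<Rightarrow> 'g \<Rightarrow> 'x \<times> (nat \<Rightarrow> 'y) \<Rightarrow> 'x \<times> (nat \<Rightarrow> 'y)" where
  "coinduced G D X a0 b0 N C a g =
     (let E = orbit_rel D X a0; F = orbit_rel G X b0 in
      (\<lambda>(x, y).
        if (\<forall>z\<in>F `` {x}. free_at D a0 z \<and> choice_at F E N C z)
        then (b0 g x,
              (\<lambda>n\<in>index_set N. a (coind_delta D a0 E N C b0 g x n)
                                 (y (coind_perm_inv E N C b0 g x n))))
        else (b0 g x, y)))"

definition coinduced_space :: "'x measure \<Rightarrow> enat \<Rightarrow> 'y measure \<Rightarrow> ('x \<times> (nat \<Rightarrow> 'y)) measure" where
  "coinduced_space X N Y = X \<Otimes>\<^sub>M (\<Pi>\<^sub>M n\<in>index_set N. Y)"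

end

theory Submission
  imports Defs "HOL-Probability.Infinite_Product_Measure"
begin

text \<open>
  Over a point \<open>x\<close> of the base, the co-induced action of \<open>g\<close> moves a sequence in \<open>Y\<^sup>N\<close> by a fibre
  map: coordinate \<open>j\<close> of the image is the coordinate \<open>\<kappa> g x j\<close> of the argument, transported by the
  element \<open>\<delta> g x j\<close> of \<open>D\<close>. Here \<open>\<kappa>\<close> is the inverse of the permutation \<open>coind_perm\<close>, and it sends \<open>j\<close>
  to \<open>i\<close> exactly if \<open>C i x\<close> and \<open>C j (b0 g x)\<close> are \<open>E\<close>-related. On the conull set of good points
  the pair \<open>(\<kappa>, \<delta>)\<close> is the unique solution of one equation (\<open>cocycle_spec\<close>, \<open>cocycle_unique\<close>). The
  cocycle identity follows, and with it the action law and the measurability; by Fubini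
  the co-induced action preserves the measure (\<open>distr_T\<close>).

  Suppose that the return measure tends to \<open>0\<close>. Correlations are additive in both arguments and
  dominated by the measure of each argument, so mixing has to be shown only for rectangles with a
  finite-dimensional cylinder in the fibre direction (\<open>correlation_tendsto_from_generator\<close>). Let \<open>J\<close>
  and \<open>K\<close> be the coordinates that the two cylinders restrict. If \<open>\<kappa> g x\<close> maps \<open>K\<close> off \<open>J\<close>, the two
  conditions in the fibre over \<open>x\<close> read different coordinates and are independent. So up to the
  measure of the set where \<open>\<kappa> g x\<close> maps some \<open>j\<close> in \<open>K\<close> to some \<open>i\<close> in \<open>J\<close>, the correlation is
  a constant times a correlation of \<open>b0\<close> (\<open>correlation_rectangles\<close>), and \<open>b0\<close> is mixing. The
  exceptional set is asymptotically null (\<open>meeting_tendsto_0\<close>): up to a small error \<open>C i\<close> and \<open>C j\<close>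
  act by finitely many elements \<open>\<alpha>\<close> and \<open>\<beta>\<close> of \<open>G\<close>, and \<open>b0 \<alpha> x\<close> is \<open>E\<close>-related to
  \<open>b0 \<beta> (b0 g x)\<close> with probability equal to the return measure of \<open>\<beta> \<otimes> g \<otimes> inv \<alpha>\<close>.

  For the converse one fibre action suffices, the trivial one. The cylinder over a set of measure
  \<open>1/2\<close> in coordinate \<open>0\<close> has measure \<open>1/2\<close>. In its correlation with itself, returns to the
  \<open>E\<close>-class contribute \<open>1/2\<close> and the other points contribute \<open>1/4\<close>, so the correlation is
  \<open>1/4\<close> plus a quarter of the return measure (\<open>correlation_trivial_fibre\<close>). If the co-induced action
  is mixing, the correlation tends to \<open>1/4\<close>, so the return measure tends to \<open>0\<close>.
\<close>

section \<open>Correlations on a generating family\<close>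

text \<open>Convergence on a \<open>\<pi>\<close>-system extends to the generated \<open>\<sigma>\<close>-algebra as soon as the measures \<open>\<nu> g\<close>
  are dominated by one finite measure: for a disjoint union the values of \<open>M\<close> on the pieces form a
  summable majorant, so that Tannery's theorem exchanges the limit with the sum, and the sets on
  which convergence holds form a Dynkin system.\<close>

lemma tendsto_measure_from_generator:
  fixes \<nu> :: "'i \<Rightarrow> 'a measure"
  assumes "finite_measure M"
    and S: "Int_stable S" "S \<subseteq> Pow (space M)" "sets M = sigma_sets (space M) S" "space M \<in> S"
    and dom: "\<forall>\<^sub>F g in L. sets (\<nu> g) = sets M \<and> (\<forall>A\<in>sets M. emeasure (\<nu> g) A \<le> emeasure M A)"
    and basic: "\<And>A. A \<in> S \<Longrightarrow> ((\<lambda>g. measure (\<nu> g) A) \<longlongrightarrow> c * measure M A) L"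
    and A: "A \<in> sets M"
  shows "((\<lambda>g. measure (\<nu> g) A) \<longlongrightarrow> c * measure M A) L"
\<comment> \<open>Tannery's theorem needs a proper filter; over the trivial filter everything converges.\<close>
proof (cases "L = bot")
  case False
  interpret finite_measure M by fact
  have fin: "\<forall>\<^sub>F g in L. finite_measure (\<nu> g) \<and> sets (\<nu> g) = sets M \<and>
      (\<forall>A\<in>sets M. measure (\<nu> g) A \<le> measure M A)"
    using dom
  proof eventually_elim
    case (elim g)
    then have sp: "space (\<nu> g) = space M" by (auto dest: sets_eq_imp_space_eq)
    have "emeasure (\<nu> g) (space M) \<le> emeasure M (space M)"
      using elim by auto
    then interpret g: finite_measure "\<nu> g"
      by (intro finite_measureI) (auto simp: sp top_unique)
    show ?case
      using elim by (auto intro: g.finite_measure_axioms simp: g.emeasure_eq_measure emeasure_eq_measure)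
  qed
  from A have "A \<in> sigma_sets (space M) S" using S by simp
  with S(1,2) show ?thesis
  proof (induction rule: sigma_sets_induct_disjoint)
    case (basic A)
    then show ?case by (rule assms(7))
  next
    case empty
    show ?case by simp
  next
    case (compl A)
    then have A: "A \<in> sets M" using S by simp
    have "((\<lambda>g. measure (\<nu> g) (space M) - measure (\<nu> g) A) \<longlongrightarrow>
        c * measure M (space M) - c * measure M A) L"
      by (intro tendsto_diff compl basic S)
    moreover have "\<forall>\<^sub>F g in L. measure (\<nu> g) (space M) - measure (\<nu> g) A = measure (\<nu> g) (space M - A)"
      using fin
    proof eventually_elim
      case (elim g)
      then interpret g: finite_measure "\<nu> g" by simp
      have "space (\<nu> g) = space M" using elim by (auto dest: sets_eq_imp_space_eq)
      then show ?case using g.finite_measure_compl[of A] elim A by simp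
    qed
    ultimately show ?case
      unfolding finite_measure_compl[OF A] right_diff_distrib by (rule Lim_transform_eventually)
  next
    case (union A)
    then have A: "range A \<subseteq> sets M" using S by simp
    have sumM: "(\<lambda>i. measure M (A i)) sums measure M (\<Union>i. A i)"
      by (rule finite_measure_UNION) (use union A in auto)
    have lim: "((\<lambda>g. \<Sum>i. measure (\<nu> g) (A i)) \<longlongrightarrow> (\<Sum>i. c * measure M (A i))) L"
    proof (rule tannerys_theorem[THEN conjunct2, THEN conjunct2])
      show "\<forall>\<^sub>F (i, g) in at_top \<times>\<^sub>F L. norm (measure (\<nu> g) (A i)) \<le> measure M (A i)"
      proof -
        have "\<forall>\<^sub>F g in L. \<forall>i. norm (measure (\<nu> g) (A i)) \<le> measure M (A i)"
          using fin by eventually_elim (use A in auto)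
        then have "\<forall>\<^sub>F (k::nat, g) in at_top \<times>\<^sub>F L. \<forall>i. norm (measure (\<nu> g) (A i)) \<le> measure M (A i)"
          by (subst eventually_prod2) auto
        then show ?thesis by eventually_elim auto
      qed
      show "summable (\<lambda>i. measure M (A i))" using sumM by (rule sums_summable)
    qed (use union False in auto)
    have "(\<Sum>i. c * measure M (A i)) = c * measure M (\<Union>i. A i)"
      using sums_mult[OF sumM] by (rule sums_unique[symmetric])
    moreover have "\<forall>\<^sub>F g in L. (\<Sum>i. measure (\<nu> g) (A i)) = measure (\<nu> g) (\<Union>i. A i)"
      using fin
    proof eventually_elim
      case (elim g)
      then interpret g: finite_measure "\<nu> g" by simp
      show ?case
        by (rule sums_unique[symmetric], rule g.finite_measure_UNION) (use elim union A in auto)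
    qed
    ultimately show ?case using Lim_transform_eventually[OF lim] by simp
  qed
qed simp

text \<open>Both arguments of a correlation are countably additive, and since \<open>T g\<close> preserves the measure,
  the correlation of \<open>A\<close> and \<open>B\<close> is at most the measure of either of them. So the generator can be
  left in one argument at a time.\<close>

lemma (in prob_space) correlation_tendsto_from_generator:
  fixes T :: "'i \<Rightarrow> 'a \<Rightarrow> 'a"
  assumes S: "Int_stable S" "S \<subseteq> Pow (space M)" "sets M = sigma_sets (space M) S" "space M \<in> S"
    and T: "\<forall>\<^sub>F g in L. T g \<in> M \<rightarrow>\<^sub>M M \<and> distr M M (T g) = M"
    and basic: "\<And>A B. A \<in> S \<Longrightarrow> B \<in> S \<Longrightarrow>
      ((\<lambda>g. prob {z \<in> A. T g z \<in> B}) \<longlongrightarrow> prob A * prob B) L"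
    and A: "A \<in> events" and B: "B \<in> events"
  shows "((\<lambda>g. prob {z \<in> A. T g z \<in> B}) \<longlongrightarrow> prob A * prob B) L"
proof -
  define \<nu> where "\<nu> A g = distr (density M (indicator A)) M (T g)" for A g
  define \<nu>' where "\<nu>' B g = density M (indicator (T g -` B \<inter> space M))" for B g
  have into: "A \<in> events \<Longrightarrow> A \<subseteq> space M" for A by (rule sets.sets_into_space)
  have \<nu>: "emeasure (\<nu> A g) B = emeasure M {z \<in> A. T g z \<in> B}"
    if "A \<in> events" "B \<in> events" "T g \<in> M \<rightarrow>\<^sub>M M" for A B g
  proof -
    have "T g -` B \<inter> space M \<in> events" using that by measurable
    moreover have "A \<inter> (T g -` B \<inter> space M) = {z \<in> A. T g z \<in> B}" using into[OF that(1)] by auto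
    ultimately show ?thesis
      using that by (simp add: \<nu>_def emeasure_distr emeasure_restricted)
  qed
  have \<nu>': "emeasure (\<nu>' B g) A = emeasure M {z \<in> A. T g z \<in> B}"
    if "A \<in> events" "B \<in> events" "T g \<in> M \<rightarrow>\<^sub>M M" for A B g
  proof -
    have "T g -` B \<inter> space M \<in> events" using that by measurable
    moreover have "(T g -` B \<inter> space M) \<inter> A = {z \<in> A. T g z \<in> B}" using into[OF that(1)] by auto
    ultimately show ?thesis
      using that by (simp add: \<nu>'_def emeasure_restricted)
  qed
  have le: "emeasure M {z \<in> A. T g z \<in> B} \<le> emeasure M B"
    if "A \<in> events" "B \<in> events" "T g \<in> M \<rightarrow>\<^sub>M M" "distr M M (T g) = M" for A B g
  proof -
    have "emeasure M {z \<in> A. T g z \<in> B} \<le> emeasure M (T g -` B \<inter> space M)"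
      by (rule emeasure_mono) (use that into[OF that(1)] in auto)
    also have "\<dots> = emeasure M B" using emeasure_distr[OF that(3,2)] that(4) by simp
    finally show ?thesis .
  qed
  have step1: "((\<lambda>g. prob {z \<in> A. T g z \<in> B}) \<longlongrightarrow> prob A * prob B) L"
    if "A \<in> S" "B \<in> events" for A B
  proof -
    have AM: "A \<in> events" using that S by auto
    have ev: "\<forall>\<^sub>F g in L. prob {z \<in> A. T g z \<in> B} = measure (\<nu> A g) B" if "B \<in> events" for B
      using T by eventually_elim (simp add: measure_def \<nu> AM that)
    have "((\<lambda>g. measure (\<nu> A g) B) \<longlongrightarrow> prob A * prob B) L"
    proof (rule tendsto_measure_from_generator[OF finite_measure_axioms S])
      show "\<forall>\<^sub>F g in L. sets (\<nu> A g) = events \<and> (\<forall>B\<in>events. emeasure (\<nu> A g) B \<le> emeasure M B)"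
        using T by eventually_elim (use AM \<nu> le in \<open>auto simp: \<nu>_def\<close>)
      show "((\<lambda>g. measure (\<nu> A g) B) \<longlongrightarrow> prob A * prob B) L" if "B \<in> S" for B
        using basic[OF \<open>A \<in> S\<close> that] tendsto_cong[OF ev[of B]] S that by auto
    qed fact
    then show ?thesis
      using tendsto_cong[OF ev[OF that(2)]] by simp
  qed
  have ev: "\<forall>\<^sub>F g in L. prob {z \<in> A. T g z \<in> B} = measure (\<nu>' B g) A" if "A \<in> events" for A
    using T by eventually_elim (simp add: measure_def \<nu>' B that)
  have "((\<lambda>g. measure (\<nu>' B g) A) \<longlongrightarrow> prob B * prob A) L"
  proof (rule tendsto_measure_from_generator[OF finite_measure_axioms S])
    have "emeasure (\<nu>' B g) A \<le> emeasure M A" if "A \<in> events" "T g \<in> M \<rightarrow>\<^sub>M M" for g A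
      using that B by (auto simp: \<nu>' intro: emeasure_mono)
    then show "\<forall>\<^sub>F g in L. sets (\<nu>' B g) = events \<and> (\<forall>A\<in>events. emeasure (\<nu>' B g) A \<le> emeasure M A)"
      using T by (auto simp: \<nu>'_def elim!: eventually_mono)
    show "((\<lambda>g. measure (\<nu>' B g) A) \<longlongrightarrow> prob B * prob A) L" if "A \<in> S" for A
      using step1[OF that B] tendsto_cong[OF ev[of A]] S that by (auto simp: mult.commute)
  qed fact
  then show ?thesis
    using tendsto_cong[OF ev[OF A]] by (simp add: mult.commute)
qed

text \<open>The definition of mixing uses images; preimages are better suited to integration. Pulling the
  intersection back along \<open>T\<close> translates one into the other, where the inverse \<open>T'\<close> is what makes
  the image measurable.\<close>

lemma (in prob_space) prob_image_Int:
  assumes T: "T \<in> M \<rightarrow>\<^sub>M M" "distr M M T = M"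
    and T': "T' \<in> M \<rightarrow>\<^sub>M M" "\<And>z. z \<in> space M \<Longrightarrow> T' (T z) = z" "\<And>z. z \<in> space M \<Longrightarrow> T (T' z) = z"
    and A: "A \<in> events" and B: "B \<in> events"
  shows "prob (T ` A \<inter> B) = prob {z \<in> A. T z \<in> B}"
proof -
  have into: "A \<subseteq> space M" using A by (rule sets.sets_into_space)
  have im: "T ` A = T' -` A \<inter> space M"
  proof safe
    fix z assume "z \<in> space M" "T' z \<in> A"
    then show "z \<in> T ` A" using T'(3) by (metis imageI)
  qed (use into T' T(1)[THEN measurable_space] in auto)
  then have ev: "T ` A \<inter> B \<in> events" using T' A B by simp
  have "prob (T ` A \<inter> B) = measure (distr M M T) (T ` A \<inter> B)" using T by simp
  also have "\<dots> = prob (T -` (T ` A \<inter> B) \<inter> space M)" by (rule measure_distr) (use T ev in auto)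
  also have "T -` (T ` A \<inter> B) \<inter> space M = {z \<in> A. T z \<in> B}"
    using into T'(2) by (auto) (metis subsetD)
  finally show ?thesis .
qed

section \<open>The cocycle of the choice functions\<close>

lemma orbit_rel_iff:
  "(x, y) \<in> orbit_rel H M a \<longleftrightarrow> x \<in> space M \<and> (\<exists>h\<in>carrier H. y = a h x)"
  by (auto simp: orbit_rel_def orbit_def)

lemma (in group_action) equiv_orbit_rel:
  assumes "E = space M"
  shows "equiv (space M) (orbit_rel G M \<phi>)"
proof -
  interpret group G using group_hom group_hom.axioms(1) by auto
  show ?thesis
  proof (intro equivI refl_onI symI transI)
    show "orbit_rel G M \<phi> \<subseteq> space M \<times> space M"
      using element_image assms by (auto simp: orbit_rel_iff)
    show "(x, x) \<in> orbit_rel G M \<phi>" if "x \<in> space M" for x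
    proof -
      have "\<phi> \<one> x = x" using that assms by (simp add: id_eq_one[symmetric])
      then show ?thesis using that by (metis orbit_rel_iff one_closed)
    qed
    show "(y, x) \<in> orbit_rel G M \<phi>" if xy: "(x, y) \<in> orbit_rel G M \<phi>" for x y
    proof -
      obtain g where g: "g \<in> carrier G" "x \<in> E" "\<phi> g x = y" using xy assms by (auto simp: orbit_rel_iff)
      then have "\<phi> (inv g) y = x" "y \<in> E" by (auto intro: orbit_sym_aux element_image)
      then show ?thesis using g(1) assms by (metis orbit_rel_iff inv_closed)
    qed
    show "(x, z) \<in> orbit_rel G M \<phi>"
      if xy: "(x, y) \<in> orbit_rel G M \<phi>" and yz: "(y, z) \<in> orbit_rel G M \<phi>" for x y z
    proof -
      obtain g h where gh: "g \<in> carrier G" "h \<in> carrier G" "x \<in> E" "y = \<phi> g x" "z = \<phi> h y"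
        using xy yz assms by (auto simp: orbit_rel_iff)
      then have "\<phi> (h \<otimes> g) x = z" by (simp add: composition_rule)
      then show ?thesis using gh assms by (metis orbit_rel_iff m_closed)
    qed
  qed
qed

text \<open>The data that do not involve the fibre action: the two actions on the base space and the choice
  functions.\<close>

locale coinduction =
  G: group G + D: group D + X: prob_space X +
  b0: group_action G "space X" b0 + a0: group_action D "space X" a0
  for G :: "('g, 'm) monoid_scheme" and D :: "('d, 'n) monoid_scheme" and X :: "'x measure"
    and b0 a0 +
  fixes E F :: "'x rel" and N :: enat and C :: "nat \<Rightarrow> 'x \<Rightarrow> 'x"
  assumes countable_G: "countable (carrier G)" and countable_D: "countable (carrier D)"
    and standard: "standard_prob_space X"
    and mp_b0: "mp_action G X b0" and mp_a0: "mp_action D X a0" and free: "free_action D X a0"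
    and F_def: "F = orbit_rel G X b0" and E_def: "E = orbit_rel D X a0"
    and choice: "choice_functions X F E N C"
begin

abbreviation "I \<equiv> index_set N"
abbreviation "\<kappa> \<equiv> coind_perm_inv E N C b0"
abbreviation "\<delta> \<equiv> coind_delta D a0 E N C b0"

definition good :: "'x \<Rightarrow> bool" where
  "good x \<longleftrightarrow> (\<forall>z\<in>F `` {x}. free_at D a0 z \<and> choice_at F E N C z)"

lemma zero_in_index: "0 \<in> I"
proof -
  have "0 < (1::enat)" by (rule zero_less_one)
  also have "1 \<le> N" using choice by (simp add: choice_functions_def)
  finally show ?thesis by (simp add: index_set_def zero_enat_def)
qed

lemma b0_measurable [measurable]: "g \<in> carrier G \<Longrightarrow> b0 g \<in> X \<rightarrow>\<^sub>M X"
  and distr_b0: "g \<in> carrier G \<Longrightarrow> distr X X (b0 g) = X"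
  and a0_measurable [measurable]: "d \<in> carrier D \<Longrightarrow> a0 d \<in> X \<rightarrow>\<^sub>M X"
  and C_measurable [measurable]: "n \<in> I \<Longrightarrow> C n \<in> X \<rightarrow>\<^sub>M X"
  using mp_b0 mp_a0 choice by (auto simp: mp_action_def choice_functions_def)

lemma b0_space [simp]: "g \<in> carrier G \<Longrightarrow> x \<in> space X \<Longrightarrow> b0 g x \<in> space X"
  and a0_space [simp]: "d \<in> carrier D \<Longrightarrow> x \<in> space X \<Longrightarrow> a0 d x \<in> space X"
  and C_space [simp]: "n \<in> I \<Longrightarrow> x \<in> space X \<Longrightarrow> C n x \<in> space X"
  using measurable_space[OF b0_measurable] measurable_space[OF a0_measurable]
    measurable_space[OF C_measurable] by auto

lemma b0_one: "x \<in> space X \<Longrightarrow> b0 \<one>\<^bsub>G\<^esub> x = x"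
  using b0.id_eq_one by (metis restrict_apply')

lemma a0_one: "x \<in> space X \<Longrightarrow> a0 \<one>\<^bsub>D\<^esub> x = x"
  using a0.id_eq_one by (metis restrict_apply')

lemma equiv_E: "equiv (space X) E" and equiv_F: "equiv (space X) F"
  unfolding E_def F_def by (auto intro: a0.equiv_orbit_rel b0.equiv_orbit_rel)

lemma E_iff: "(x, y) \<in> E \<longleftrightarrow> x \<in> space X \<and> (\<exists>d\<in>carrier D. y = a0 d x)"
  and F_iff: "(x, y) \<in> F \<longleftrightarrow> x \<in> space X \<and> (\<exists>g\<in>carrier G. y = b0 g x)"
  by (simp_all add: E_def F_def orbit_rel_iff)

lemma F_class_b0: "g \<in> carrier G \<Longrightarrow> x \<in> space X \<Longrightarrow> F `` {b0 g x} = F `` {x}"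
  by (rule equiv_class_eq[OF equiv_F, symmetric]) (auto simp: F_iff)

lemma good_b0: "g \<in> carrier G \<Longrightarrow> x \<in> space X \<Longrightarrow> good (b0 g x) \<longleftrightarrow> good x"
  by (simp add: good_def F_class_b0)

lemma goodD:
  assumes "good x" "x \<in> space X"
  shows "choice_at F E N C x" "C 0 x = x" "inj_on (\<lambda>n. C n x) I"
    "n \<in> I \<Longrightarrow> (x, C n x) \<in> F" "n \<in> I \<Longrightarrow> free_at D a0 (C n x)"
    "(x, y) \<in> F \<Longrightarrow> \<exists>!n. n \<in> I \<and> (C n x, y) \<in> E"
proof -
  have "(x, x) \<in> F" using equiv_F assms(2) by (auto simp: equiv_def refl_on_def)
  then show ch: "choice_at F E N C x" using assms(1) by (auto simp: good_def)
  then show "C 0 x = x" "inj_on (\<lambda>n. C n x) I" by (auto simp: choice_at_def)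
  show F: "n \<in> I \<Longrightarrow> (x, C n x) \<in> F" for n using ch by (auto simp: choice_at_def)
  show "n \<in> I \<Longrightarrow> free_at D a0 (C n x)" using F[of n] assms(1) by (auto simp: good_def)
  show "\<exists>!n. n \<in> I \<and> (C n x, y) \<in> E" if "(x, y) \<in> F"
  proof -
    have ex: "\<exists>!z. z \<in> (\<lambda>n. C n x) ` I \<and> (z, y) \<in> E" using ch that by (auto simp: choice_at_def)
    then obtain n where n: "n \<in> I" "(C n x, y) \<in> E" by blast
    moreover have "m = n" if "m \<in> I" "(C m x, y) \<in> E" for m
      using ex n that \<open>inj_on (\<lambda>n. C n x) I\<close> by (metis (no_types, lifting) image_eqI inj_onD)
    ultimately show ?thesis by blast
  qed
qed

text \<open>On a good orbit the definite descriptions behind \<open>\<kappa>\<close> and \<open>\<delta>\<close> can be forgotten: together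
  they are the only solution \<open>(k, d)\<close> of the equation \<open>a0 d (C k x) = C n (b0 g x)\<close>. The points
  \<open>C k x\<close> and the points \<open>C m (b0 g x)\<close> are two transversals of the same \<open>F\<close>-class, so each
  \<open>E\<close>-class in it pairs one \<open>k\<close> with one \<open>m\<close>, and freeness makes \<open>d\<close> unique.\<close>

lemma
  assumes x: "good x" "x \<in> space X" and g: "g \<in> carrier G" and n: "n \<in> I"
  shows cocycle_spec: "\<kappa> g x n \<in> I" "\<delta> g x n \<in> carrier D" "a0 (\<delta> g x n) (C (\<kappa> g x n) x) = C n (b0 g x)"
    and cocycle_unique: "k \<in> I \<Longrightarrow> d \<in> carrier D \<Longrightarrow> a0 d (C k x) = C n (b0 g x) \<Longrightarrow>
      k = \<kappa> g x n \<and> d = \<delta> g x n"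
proof -
  let ?p = "coind_perm E N C b0 g x"
  have gx: "good (b0 g x)" "b0 g x \<in> space X" using x g by (auto simp: good_b0)
  have class_eq: "E `` {C k x} = E `` {C m (b0 g x)} \<longleftrightarrow> (C k x, C m (b0 g x)) \<in> E"
    if "k \<in> I" "m \<in> I" for k m
    using eq_equiv_class_iff[OF equiv_E] that x gx by auto
  have sym: "(u, v) \<in> E \<Longrightarrow> (v, u) \<in> E" for u v using equiv_E by (auto simp: equiv_def sym_def)
  \<comment> \<open>Two transversals of one class: every row and every column of the incidence relation has exactly one entry.\<close>
  have col: "\<exists>!m. m \<in> I \<and> (C k x, C m (b0 g x)) \<in> E" if "k \<in> I" for k
    using goodD(6)[OF gx, of "C k x"] goodD(4)[OF x that] F_class_b0[OF g x(2)] sym by blast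
  have row: "\<exists>!k. k \<in> I \<and> (C k x, C m (b0 g x)) \<in> E" if "m \<in> I" for m
    using goodD(6)[OF x, of "C m (b0 g x)"] goodD(4)[OF gx that] F_class_b0[OF g x(2)] by blast
  have p: "?p k \<in> I \<and> (C k x, C (?p k) (b0 g x)) \<in> E" if "k \<in> I" for k
  proof -
    have "?p k = (THE m. m \<in> I \<and> (C k x, C m (b0 g x)) \<in> E)"
      unfolding coind_perm_def using class_eq that by (metis (no_types, lifting))
    then show ?thesis using theI'[OF col[OF that]] by simp
  qed
  have inj: "inj_on ?p I"
    by (rule inj_onI) (metis p row)
  obtain k where k: "k \<in> I" "(C k x, C n (b0 g x)) \<in> E" using row[OF n] by blast
  then have "?p k = n" using p[of k] col[of k] n by blast
  then have \<kappa>: "\<kappa> g x n = k"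
    unfolding coind_perm_inv_def using inj k by (auto intro: the_inv_into_f_eq)
  obtain d where d: "d \<in> carrier D" "a0 d (C k x) = C n (b0 g x)"
    using k by (auto simp: E_iff)
  have d_unique: "d' = d" if "d' \<in> carrier D" "a0 d' (C k x) = C n (b0 g x)" for d'
  proof -
    have "a0 (inv\<^bsub>D\<^esub> d \<otimes>\<^bsub>D\<^esub> d') (C k x) = C k x"
      using a0.orbit_sym_aux[OF d(1) _ d(2)] that d k x by (simp add: a0.composition_rule)
    then have "inv\<^bsub>D\<^esub> d \<otimes>\<^bsub>D\<^esub> d' = \<one>\<^bsub>D\<^esub>"
      using goodD(5)[OF x k(1)] that d by (auto simp: free_at_def)
    then show ?thesis using that d
      by (metis D.inv_closed D.inv_equality D.inv_inv)
  qed
  have \<delta>: "\<delta> g x n = d"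
    unfolding coind_delta_def \<kappa> by (rule the_equality) (use d d_unique in blast)+
  show "\<kappa> g x n \<in> I" "\<delta> g x n \<in> carrier D" "a0 (\<delta> g x n) (C (\<kappa> g x n) x) = C n (b0 g x)"
    using k d by (auto simp: \<kappa> \<delta>)
  show "k' = \<kappa> g x n \<and> d' = \<delta> g x n"
    if "k' \<in> I" "d' \<in> carrier D" "a0 d' (C k' x) = C n (b0 g x)" for k' d'
  proof -
    have "(C k' x, C n (b0 g x)) \<in> E"
      using that C_space[OF that(1) x(2)] unfolding E_iff by metis
    then have "k' = k" using row[OF n] k that by blast
    then show ?thesis using that d_unique[of d'] unfolding \<kappa> \<delta> by blast
  qed
qed

lemma cocycle_one:
  assumes x: "good x" "x \<in> space X" and n: "n \<in> I"
  shows "\<kappa> \<one>\<^bsub>G\<^esub> x n = n" "\<delta> \<one>\<^bsub>G\<^esub> x n = \<one>\<^bsub>D\<^esub>"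
  using cocycle_unique[OF x G.one_closed n n D.one_closed] x n by (auto simp: a0_one b0_one)

text \<open>Composing the equation that characterises the cocycle at \<open>x\<close> with the one at \<open>b0 h x\<close> gives a
  solution of the equation for the product, and solutions are unique.\<close>

lemma cocycle_mult:
  assumes x: "good x" "x \<in> space X" and g: "g \<in> carrier G" "h \<in> carrier G" and n: "n \<in> I"
  shows "\<kappa> (g \<otimes>\<^bsub>G\<^esub> h) x n = \<kappa> h x (\<kappa> g (b0 h x) n)"
    "\<delta> (g \<otimes>\<^bsub>G\<^esub> h) x n = \<delta> g (b0 h x) n \<otimes>\<^bsub>D\<^esub> \<delta> h x (\<kappa> g (b0 h x) n)"
proof -
  have hx: "good (b0 h x)" "b0 h x \<in> space X" using x g by (auto simp: good_b0)
  note 1 = cocycle_spec[OF hx g(1) n]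
  note 2 = cocycle_spec[OF x g(2) 1(1)]
  have "a0 (\<delta> g (b0 h x) n \<otimes>\<^bsub>D\<^esub> \<delta> h x (\<kappa> g (b0 h x) n)) (C (\<kappa> h x (\<kappa> g (b0 h x) n)) x)
      = C n (b0 (g \<otimes>\<^bsub>G\<^esub> h) x)"
    using 1 2 x g by (simp add: a0.composition_rule b0.composition_rule)
  from cocycle_unique[OF x _ n 2(1) _ this] show
    "\<kappa> (g \<otimes>\<^bsub>G\<^esub> h) x n = \<kappa> h x (\<kappa> g (b0 h x) n)"
    "\<delta> (g \<otimes>\<^bsub>G\<^esub> h) x n = \<delta> g (b0 h x) n \<otimes>\<^bsub>D\<^esub> \<delta> h x (\<kappa> g (b0 h x) n)"
    using 1 2 g by auto
qed

text \<open>By the cocycle identity the inverse group element undoes \<open>\<kappa>\<close>.\<close>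

lemma inj_\<kappa>:
  assumes x: "good x" "x \<in> space X" and g: "g \<in> carrier G"
  shows "inj_on (\<kappa> g x) I"
proof (rule inj_on_inverseI)
  fix n assume n: "n \<in> I"
  have hx: "good (b0 g x)" "b0 g x \<in> space X" using x g by (auto simp: good_b0)
  have *: "b0 (inv\<^bsub>G\<^esub> g) (b0 g x) = x" using x g b0.orbit_sym_aux by blast
  have "\<kappa> (g \<otimes>\<^bsub>G\<^esub> inv\<^bsub>G\<^esub> g) (b0 g x) n = \<kappa> (inv\<^bsub>G\<^esub> g) (b0 g x) (\<kappa> g x n)"
    using cocycle_mult[OF hx g G.inv_closed[OF g] n] by (simp add: *)
  then show "\<kappa> (inv\<^bsub>G\<^esub> g) (b0 g x) (\<kappa> g x n) = n"
    using cocycle_one[OF hx n] g by simp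
qed

end

section \<open>Measurability of the cocycle\<close>

lemma standard_prob_space_imp_prob_space:
  assumes "standard_prob_space M"
  shows "prob_space M"
proof -
  let ?R = "restrict_space lborel {0..1::real}"
  obtain f where f: "f \<in> M \<rightarrow>\<^sub>M ?R" "distr M ?R f = ?R"
    using assms unfolding standard_prob_space_def by blast
  have "prob_space ?R"
    by (rule prob_spaceI) (simp add: space_restrict_space emeasure_restrict_space)
  then show ?thesis by (intro prob_space_distrD[OF f(1)]) (unfold f(2))
qed

text \<open>The diagonal of a standard space is measurable, because the space embeds into the real line.\<close>

lemma standard_prob_space_pred_eq:
  assumes M: "standard_prob_space M" and u: "u \<in> L \<rightarrow>\<^sub>M M" and v: "v \<in> L \<rightarrow>\<^sub>M M"
  shows "Measurable.pred L (\<lambda>z. u z = v z)"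
proof -
  obtain f :: "_ \<Rightarrow> real" and g where f: "f \<in> M \<rightarrow>\<^sub>M restrict_space lborel {0..1}" and g: "\<And>x. x \<in> space M \<Longrightarrow> g (f x) = x"
    using M unfolding standard_prob_space_def by blast
  have "f \<in> borel_measurable M"
    using f by (simp add: measurable_restrict_space2_iff)
  then have "Measurable.pred L (\<lambda>z. f (u z) = f (v z))"
    using u v by measurable
  moreover have "f (u z) = f (v z) \<longleftrightarrow> u z = v z" if "z \<in> space L" for z
    using g measurable_space[OF u that] measurable_space[OF v that] by metis
  ultimately show ?thesis by (simp cong: measurable_cong)
qed

lemma pred_countable_Ball:
  assumes "countable A" "\<And>i. i \<in> A \<Longrightarrow> Measurable.pred M (P i)"
  shows "Measurable.pred M (\<lambda>x. \<forall>i\<in>A. P i x)"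
  using assms unfolding pred_def by (intro sets.sets_Collect_countable_All') auto

lemma pred_countable_Bex:
  assumes "countable A" "\<And>i. i \<in> A \<Longrightarrow> Measurable.pred M (P i)"
  shows "Measurable.pred M (\<lambda>x. \<exists>i\<in>A. P i x)"
  using assms unfolding pred_def by (intro sets.sets_Collect_countable_Ex') auto

context coinduction
begin

lemma pred_eq: "u \<in> L \<rightarrow>\<^sub>M X \<Longrightarrow> v \<in> L \<rightarrow>\<^sub>M X \<Longrightarrow> Measurable.pred L (\<lambda>z. u z = v z)"
  using standard by (rule standard_prob_space_pred_eq)

lemma pred_E:
  assumes u: "u \<in> L \<rightarrow>\<^sub>M X" and v: "v \<in> L \<rightarrow>\<^sub>M X"
  shows "Measurable.pred L (\<lambda>z. (u z, v z) \<in> E)"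
proof -
  have "Measurable.pred L (\<lambda>z. \<exists>d\<in>carrier D. v z = a0 d (u z))"
    by (intro pred_countable_Bex countable_D pred_eq v measurable_compose[OF u a0_measurable])
  moreover have "(u z, v z) \<in> E \<longleftrightarrow> (\<exists>d\<in>carrier D. v z = a0 d (u z))" if "z \<in> space L" for z
    using measurable_space[OF u that] by (simp add: E_iff)
  ultimately show ?thesis by (simp cong: measurable_cong)
qed

lemma countable_index: "countable I"
  by simp

lemma F_class: "x \<in> space X \<Longrightarrow> F `` {x} = (\<lambda>g. b0 g x) ` carrier G"
  by (auto simp: F_iff)

text \<open>Since orbits are countable, every quantifier in the transversal property can be taken over one of
  the countable sets \<open>I\<close> and \<open>carrier G\<close>; this form shows that the property is measurable.\<close>

lemma choice_at_iff:
  assumes x: "x \<in> space X"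
  shows "choice_at F E N C x \<longleftrightarrow> C 0 x = x
    \<and> (\<forall>n\<in>I. \<forall>m\<in>I. C n x = C m x \<longrightarrow> n = m)
    \<and> (\<forall>n\<in>I. \<exists>g\<in>carrier G. C n x = b0 g x)
    \<and> (\<forall>g\<in>carrier G. \<exists>n\<in>I. (C n x, b0 g x) \<in> E \<and> (\<forall>m\<in>I. (C m x, b0 g x) \<in> E \<longrightarrow> C m x = C n x))"
proof -
  note F = F_class[OF x]
  have 1: "(\<exists>!z. z \<in> (\<lambda>n. C n x) ` I \<and> (z, y) \<in> E) \<longleftrightarrow>
      (\<exists>n\<in>I. (C n x, y) \<in> E \<and> (\<forall>m\<in>I. (C m x, y) \<in> E \<longrightarrow> C m x = C n x))" for y
    unfolding Ex1_def by blast
  have 2: "(\<lambda>n. C n x) ` I \<subseteq> F `` {x} \<longleftrightarrow> (\<forall>n\<in>I. \<exists>g\<in>carrier G. C n x = b0 g x)"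
    unfolding F by blast
  show ?thesis
    unfolding choice_at_def inj_on_def 1 2 unfolding F ball_simps ..
qed

lemma pred_choice_at: "Measurable.pred X (choice_at F E N C)"
proof -
  have "Measurable.pred X (\<lambda>x. C 0 x = x
    \<and> (\<forall>n\<in>I. \<forall>m\<in>I. C n x = C m x \<longrightarrow> n = m)
    \<and> (\<forall>n\<in>I. \<exists>g\<in>carrier G. C n x = b0 g x)
    \<and> (\<forall>g\<in>carrier G. \<exists>n\<in>I. (C n x, b0 g x) \<in> E \<and> (\<forall>m\<in>I. (C m x, b0 g x) \<in> E \<longrightarrow> C m x = C n x)))"
    by (intro pred_intros_logic pred_countable_Ball pred_countable_Bex countable_index countable_G
        pred_eq pred_E b0_measurable C_measurable zero_in_index measurable_ident) auto
  then show ?thesis by (simp add: choice_at_iff cong: measurable_cong)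
qed

lemma pred_free_at: "Measurable.pred X (free_at D a0)"
proof -
  have "Measurable.pred X (\<lambda>x. \<forall>d\<in>carrier D. a0 d x = x \<longrightarrow> d = \<one>\<^bsub>D\<^esub>)"
    by (intro pred_intros_logic pred_countable_Ball pred_countable_Bex countable_D
        pred_eq a0_measurable measurable_ident) auto
  then show ?thesis by (simp add: free_at_def[abs_def])
qed

lemma good_iff:
  "x \<in> space X \<Longrightarrow> good x \<longleftrightarrow> (\<forall>g\<in>carrier G. free_at D a0 (b0 g x) \<and> choice_at F E N C (b0 g x))"
  unfolding good_def F_class by simp

lemma pred_good [measurable]: "Measurable.pred X good"
proof -
  have "Measurable.pred X (\<lambda>x. \<forall>g\<in>carrier G. free_at D a0 (b0 g x) \<and> choice_at F E N C (b0 g x))"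
    by (intro pred_intros_logic pred_countable_Ball pred_countable_Bex countable_G
        measurable_compose[OF b0_measurable pred_free_at] measurable_compose[OF b0_measurable pred_choice_at])
  then show ?thesis by (simp add: good_iff cong: measurable_cong)
qed

lemma AE_good: "AE x in X. good x"
proof -
  have ae: "AE x in X. free_at D a0 x \<and> choice_at F E N C x"
    using free choice by (auto simp: free_action_def choice_functions_def)
  have "AE x in X. free_at D a0 (b0 g x) \<and> choice_at F E N C (b0 g x)" if "g \<in> carrier G" for g
    by (rule AE_distrD[OF b0_measurable[OF that]]) (unfold distr_b0[OF that], rule ae)
  then have "AE x in X. \<forall>g\<in>carrier G. free_at D a0 (b0 g x) \<and> choice_at F E N C (b0 g x)"
    using countable_G by (simp add: AE_ball_countable)
  then show ?thesis by (rule AE_mp) (auto simp: good_iff)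
qed

text \<open>The pair \<open>(\<kappa>, \<delta>)\<close>, given an arbitrary admissible value off the good set, where the definite
  descriptions are meaningless. This makes it a measurable function with countable range on the
  whole space, so that the co-induced action can be glued from countably many pieces.\<close>

definition cocycle_pair :: "'g \<Rightarrow> nat \<Rightarrow> 'x \<Rightarrow> nat \<times> 'd" where
  "cocycle_pair g n x = (if good x then (\<kappa> g x n, \<delta> g x n) else (n, \<one>\<^bsub>D\<^esub>))"

lemma cocycle_pair_measurable [measurable]:
  assumes g: "g \<in> carrier G" and n: "n \<in> I"
  shows "cocycle_pair g n \<in> X \<rightarrow>\<^sub>M count_space (I \<times> carrier D)"
proof (subst measurable_count_space_eq_countable, safe)
  show "countable (I \<times> carrier D)" using countable_D by simp
next
  fix x assume x: "x \<in> space X"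
  show "cocycle_pair g n x \<in> I \<times> carrier D"
    using cocycle_spec[OF _ x g n] n by (auto simp: cocycle_pair_def)
next
  fix k d assume kd: "k \<in> I" "d \<in> carrier D"
  have "cocycle_pair g n x = (k, d) \<longleftrightarrow>
      (good x \<and> a0 d (C k x) = C n (b0 g x) \<or> \<not> good x \<and> n = k \<and> \<one>\<^bsub>D\<^esub> = d)" if x: "x \<in> space X" for x
  proof (cases "good x")
    case True
    have "\<kappa> g x n = k \<and> \<delta> g x n = d \<longleftrightarrow> a0 d (C k x) = C n (b0 g x)"
      using cocycle_spec(3)[OF True x g n] cocycle_unique[OF True x g n kd] by metis
    then show ?thesis using True by (simp add: cocycle_pair_def)
  qed (simp add: cocycle_pair_def)
  then have "cocycle_pair g n -` {(k, d)} \<inter> space X =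
      {x \<in> space X. good x \<and> a0 d (C k x) = C n (b0 g x) \<or> \<not> good x \<and> n = k \<and> \<one>\<^bsub>D\<^esub> = d}"
    by blast
  moreover have "Measurable.pred X (\<lambda>x. good x \<and> a0 d (C k x) = C n (b0 g x) \<or> \<not> good x \<and> n = k \<and> \<one>\<^bsub>D\<^esub> = d)"
    using kd g n
    by (intro pred_intros_logic pred_good pred_eq measurable_compose[OF C_measurable a0_measurable]
        measurable_compose[OF b0_measurable C_measurable]) simp_all
  ultimately show "cocycle_pair g n -` {(k, d)} \<inter> space X \<in> sets X" by (simp add: pred_def)
qed

end

section \<open>The co-induced action\<close>

locale coinduced_action = coinduction G D X b0 a0 E F N C + Y: prob_space Y +
    a: group_action D "space Y" a
  for G :: "('g, 'm) monoid_scheme" and D :: "('d, 'n) monoid_scheme" and X :: "'x measure"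
    and b0 a0 E F N C and Y :: "'y measure" and a +
  assumes mp_a: "mp_action D Y a"
begin

abbreviation "P \<equiv> \<Pi>\<^sub>M n\<in>I. Y"
abbreviation "Z \<equiv> coinduced_space X N Y"
abbreviation "T \<equiv> coinduced G D X a0 b0 N C a"

definition fibre_map :: "'g \<Rightarrow> 'x \<Rightarrow> (nat \<Rightarrow> 'y) \<Rightarrow> nat \<Rightarrow> 'y" where
  "fibre_map g x y = (\<lambda>n\<in>I. a (\<delta> g x n) (y (\<kappa> g x n)))"

lemma a_measurable [measurable]: "d \<in> carrier D \<Longrightarrow> a d \<in> Y \<rightarrow>\<^sub>M Y"
  and distr_a: "d \<in> carrier D \<Longrightarrow> distr Y Y (a d) = Y"
  using mp_a by (auto simp: mp_action_def)

sublocale P: product_prob_space "\<lambda>_. Y" I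
  by unfold_locales

lemma Z_eq: "Z = X \<Otimes>\<^sub>M P"
  by (simp add: coinduced_space_def)

sublocale Z: prob_space Z
proof -
  interpret pair_prob_space X P by unfold_locales
  show "prob_space Z" unfolding Z_eq by unfold_locales
qed

lemma T_eq: "T g (x, y) = (b0 g x, if good x then fibre_map g x y else y)"
  by (simp add: coinduced_def Let_def good_def fibre_map_def F_def[symmetric] E_def[symmetric])

lemma a_one: "y \<in> space Y \<Longrightarrow> a \<one>\<^bsub>D\<^esub> y = y"
  using a.id_eq_one by (metis restrict_apply')

lemma fibre_map_space:
  assumes "good x" "x \<in> space X" "g \<in> carrier G" "y \<in> space P"
  shows "fibre_map g x y \<in> space P"
  using cocycle_spec[OF assms(1-3)] assms(4) measurable_space[OF a_measurable]
  by (auto simp: fibre_map_def space_PiM PiE_iff)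

lemma T_one:
  assumes "z \<in> space Z"
  shows "T \<one>\<^bsub>G\<^esub> z = z"
proof -
  obtain x y where z: "z = (x, y)" "x \<in> space X" "y \<in> space P"
    using assms by (auto simp: Z_eq space_pair_measure)
  have "fibre_map \<one>\<^bsub>G\<^esub> x y = y" if "good x"
    using z cocycle_one[OF that z(2)]
    by (auto simp: fibre_map_def space_PiM PiE_iff a_one extensional_def)
  then show ?thesis using z by (simp add: T_eq b0_one)
qed

lemma T_mult:
  assumes "z \<in> space Z" and g: "g \<in> carrier G" "h \<in> carrier G"
  shows "T (g \<otimes>\<^bsub>G\<^esub> h) z = T g (T h z)"
proof -
  obtain x y where z: "z = (x, y)" "x \<in> space X" "y \<in> space P"
    using assms by (auto simp: Z_eq space_pair_measure)
  have "fibre_map (g \<otimes>\<^bsub>G\<^esub> h) x y = fibre_map g (b0 h x) (fibre_map h x y)" if x: "good x"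
  proof
    fix n
    show "fibre_map (g \<otimes>\<^bsub>G\<^esub> h) x y n = fibre_map g (b0 h x) (fibre_map h x y) n"
    proof (cases "n \<in> I")
      case n: True
      have hx: "good (b0 h x)" "b0 h x \<in> space X" using x g z by (auto simp: good_b0)
      note 1 = cocycle_spec[OF hx g(1) n]
      note 2 = cocycle_spec[OF x z(2) g(2) 1(1)]
      have "y (\<kappa> h x (\<kappa> g (b0 h x) n)) \<in> space Y"
        using z 2 by (auto simp: space_PiM)
      then show ?thesis
        using n 1 2 cocycle_mult[OF x z(2) g n]
        by (simp add: fibre_map_def a.composition_rule)
    qed (simp add: fibre_map_def)
  qed
  then show ?thesis using z g by (simp add: T_eq b0.composition_rule good_b0)
qed

lemma T_measurable [measurable]:
  assumes g: "g \<in> carrier G"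
  shows "T g \<in> Z \<rightarrow>\<^sub>M Z"
proof -
  have comp: "(\<lambda>z. a (snd (cocycle_pair g n (fst z))) (snd z (fst (cocycle_pair g n (fst z))))) \<in> X \<Otimes>\<^sub>M P \<rightarrow>\<^sub>M Y"
    if n: "n \<in> I" for n
  proof (rule measurable_compose_countable'[where I = "I \<times> carrier D" and g = "\<lambda>z. cocycle_pair g n (fst z)"])
    show "(\<lambda>z. a (snd i) (snd z (fst i))) \<in> X \<Otimes>\<^sub>M P \<rightarrow>\<^sub>M Y" if "i \<in> I \<times> carrier D" for i
    proof -
      have "(\<lambda>z. snd z (fst i)) \<in> X \<Otimes>\<^sub>M P \<rightarrow>\<^sub>M Y"
        using that by (intro measurable_compose[OF measurable_snd measurable_component_singleton]) auto
      then show ?thesis using that by (intro measurable_compose[OF _ a_measurable]) auto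
    qed
    show "(\<lambda>z. cocycle_pair g n (fst z)) \<in> X \<Otimes>\<^sub>M P \<rightarrow>\<^sub>M count_space (I \<times> carrier D)"
      by (rule measurable_compose[OF measurable_fst cocycle_pair_measurable[OF g n]])
    show "countable (I \<times> carrier D)" using countable_D by simp
  qed
  have "(\<lambda>z. (b0 g (fst z), if good (fst z)
        then (\<lambda>n\<in>I. a (snd (cocycle_pair g n (fst z))) (snd z (fst (cocycle_pair g n (fst z)))))
        else snd z)) \<in> X \<Otimes>\<^sub>M P \<rightarrow>\<^sub>M X \<Otimes>\<^sub>M P"
    using g comp
    by (intro measurable_Pair measurable_If measurable_restrict measurable_snd
        measurable_compose[OF measurable_fst b0_measurable] predE
        measurable_compose[OF measurable_fst pred_good])
  also have "(\<lambda>z. (b0 g (fst z), if good (fst z)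
        then (\<lambda>n\<in>I. a (snd (cocycle_pair g n (fst z))) (snd z (fst (cocycle_pair g n (fst z)))))
        else snd z)) = T g"
    by (auto simp: T_eq fun_eq_iff fibre_map_def cocycle_pair_def)
  finally show ?thesis by (simp add: Z_eq)
qed

text \<open>Under the fibre map of \<open>g\<close> the coordinate \<open>j\<close> of the image reads only the coordinate \<open>\<kappa> g x j\<close>
  of the point. These source coordinates are distinct, and if they avoid \<open>J\<close>, then all
  the conditions on the point and on its image concern different coordinates and are independent.\<close>

lemma fibre_rectangle:
  assumes x: "good x" "x \<in> space X" and g: "g \<in> carrier G"
    and J: "finite J" "J \<subseteq> I" "\<And>i. i \<in> J \<Longrightarrow> V i \<in> sets Y"
    and K: "finite K" "K \<subseteq> I" "\<And>i. i \<in> K \<Longrightarrow> W i \<in> sets Y"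
    and disj: "\<kappa> g x ` K \<inter> J = {}"
  shows "emeasure P {y\<in>space P. (\<forall>i\<in>J. y i \<in> V i) \<and> (\<forall>j\<in>K. fibre_map g x y j \<in> W j)} =
    (\<Prod>i\<in>J. emeasure Y (V i)) * (\<Prod>j\<in>K. emeasure Y (W j))"
proof -
  note spec = cocycle_spec[OF x g]
  have inj: "inj_on (\<kappa> g x) K" using inj_\<kappa>[OF x g] K(2) by (rule inj_on_subset)
  \<comment> \<open>Each condition on the image is carried over to the source coordinate that it reads.\<close>
  define U where "U i = (if i \<in> J then V i else
      (let j = the_inv_into K (\<kappa> g x) i in a (\<delta> g x j) -` W j \<inter> space Y))" for i
  have UJ: "U i = V i" if "i \<in> J" for i using that by (simp add: U_def)
  have UK: "U (\<kappa> g x j) = a (\<delta> g x j) -` W j \<inter> space Y" if "j \<in> K" for j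
    using that disj by (auto simp: U_def the_inv_into_f_f[OF inj] Let_def)
  have UK': "U (\<kappa> g x j) \<in> sets Y" "emeasure Y (U (\<kappa> g x j)) = emeasure Y (W j)" if j: "j \<in> K" for j
  proof -
    have d: "\<delta> g x j \<in> carrier D" using spec(2) j K by auto
    show "U (\<kappa> g x j) \<in> sets Y" unfolding UK[OF j] using a_measurable[OF d] K(3)[OF j] by (rule measurable_sets)
    show "emeasure Y (U (\<kappa> g x j)) = emeasure Y (W j)"
      using emeasure_distr[OF a_measurable[OF d] K(3)[OF j]] distr_a[OF d] UK[OF j] by simp
  qed
  have mem: "y i \<in> space Y" if "y \<in> space P" "i \<in> I" for y i using that by (auto simp: space_PiM)
  have "{y\<in>space P. (\<forall>i\<in>J. y i \<in> V i) \<and> (\<forall>j\<in>K. fibre_map g x y j \<in> W j)} =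
      {y\<in>space P. \<forall>i\<in>J \<union> \<kappa> g x ` K. y i \<in> U i}"
    using K(2) spec(1) by (auto simp: ball_Un UJ UK fibre_map_def mem subset_eq)
  also have "emeasure P \<dots> = (\<Prod>i\<in>J \<union> \<kappa> g x ` K. emeasure Y (U i))"
    using J K spec(1) UJ UK' by (intro P.emeasure_PiM_Collect) auto
  also have "\<dots> = (\<Prod>i\<in>J. emeasure Y (U i)) * (\<Prod>i\<in>\<kappa> g x ` K. emeasure Y (U i))"
    using J K disj by (intro prod.union_disjoint) auto
  also have "\<dots> = (\<Prod>i\<in>J. emeasure Y (V i)) * (\<Prod>j\<in>K. emeasure Y (W j))"
    by (simp add: UJ UK' prod.reindex[OF inj])
  finally show ?thesis .
qed

lemma fibre_map_measurable:
  assumes x: "good x" "x \<in> space X" and g: "g \<in> carrier G"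
  shows "fibre_map g x \<in> P \<rightarrow>\<^sub>M P"
  unfolding fibre_map_def[abs_def]
proof (rule measurable_restrict)
  fix n assume n: "n \<in> I"
  note spec = cocycle_spec[OF x g n]
  show "(\<lambda>y. a (\<delta> g x n) (y (\<kappa> g x n))) \<in> P \<rightarrow>\<^sub>M Y"
    using measurable_component_singleton[OF spec(1)] a_measurable[OF spec(2)] by (rule measurable_compose)
qed

lemma distr_fibre_map:
  assumes x: "good x" "x \<in> space X" and g: "g \<in> carrier G"
  shows "distr P P (fibre_map g x) = P"
proof (rule P.PiM_eq)
  fix K W assume K: "finite K" "K \<subseteq> I" "\<And>j. j \<in> K \<Longrightarrow> W j \<in> sets Y"
  note m = fibre_map_measurable[OF x g]
  have ev: "prod_emb I (\<lambda>_. Y) K (\<Pi>\<^sub>E j\<in>K. W j) \<in> sets P"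
    using K by (intro measurable_prod_emb sets_PiM_I_finite) auto
  have "fibre_map g x -` prod_emb I (\<lambda>_. Y) K (\<Pi>\<^sub>E j\<in>K. W j) \<inter> space P =
      {y\<in>space P. (\<forall>i\<in>{}. y i \<in> space Y) \<and> (\<forall>j\<in>K. fibre_map g x y j \<in> W j)}"
    using measurable_space[OF m] K(2) by (auto simp: prod_emb_def space_PiM PiE_iff extensional_def)
  then show "emeasure (distr P P (fibre_map g x)) (prod_emb I (\<lambda>_. Y) K (\<Pi>\<^sub>E j\<in>K. W j)) =
      (\<Prod>j\<in>K. emeasure Y (W j))"
    using fibre_rectangle[OF x g _ _ _ K, of "{}"] by (simp add: emeasure_distr[OF m ev])
qed simp

lemma slice_T:
  assumes x: "good x" "x \<in> space X" and g: "g \<in> carrier G"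
  shows "Pair x -` (T g -` B \<inter> space Z) = fibre_map g x -` (Pair (b0 g x) -` B) \<inter> space P"
  using x by (auto simp: T_eq Z_eq space_pair_measure)

text \<open>By Fubini, this follows because the base action preserves \<open>X\<close> and almost every fibre map
  preserves \<open>P\<close>.\<close>

lemma distr_T:
  assumes g: "g \<in> carrier G"
  shows "distr Z Z (T g) = Z"
proof (rule measure_eqI)
  fix B assume "B \<in> sets (distr Z Z (T g))"
  then have B: "B \<in> sets Z" by simp
  then have B': "B \<in> sets (X \<Otimes>\<^sub>M P)" by (simp add: Z_eq)
  have TB: "T g -` B \<inter> space Z \<in> sets (X \<Otimes>\<^sub>M P)"
    using measurable_sets[OF T_measurable[OF g] B] by (simp add: Z_eq)
  have "emeasure (distr Z Z (T g)) B = emeasure (X \<Otimes>\<^sub>M P) (T g -` B \<inter> space Z)"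
    using emeasure_distr[OF T_measurable[OF g] B] by (simp add: Z_eq)
  also have "\<dots> = (\<integral>\<^sup>+x. emeasure P (Pair x -` (T g -` B \<inter> space Z)) \<partial>X)"
    by (rule P.emeasure_pair_measure_alt[OF TB])
  also have "\<dots> = (\<integral>\<^sup>+x. emeasure P (Pair (b0 g x) -` B) \<partial>X)"
  proof (rule nn_integral_cong_AE)
    have "emeasure P (Pair x -` (T g -` B \<inter> space Z)) = emeasure P (Pair (b0 g x) -` B)"
      if "good x" "x \<in> space X" for x
      unfolding slice_T[OF that g]
      using emeasure_distr[OF fibre_map_measurable[OF that g] sets_Pair1[OF B']]
        distr_fibre_map[OF that g] by simp
    then show "AE x in X. emeasure P (Pair x -` (T g -` B \<inter> space Z)) = emeasure P (Pair (b0 g x) -` B)"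
      using AE_good by (auto elim!: AE_mp)
  qed
  also have "\<dots> = (\<integral>\<^sup>+x. emeasure P (Pair x -` B) \<partial>distr X X (b0 g))"
    by (rule nn_integral_distr[symmetric]) (use g P.measurable_emeasure_Pair[OF B'] in auto)
  also have "\<dots> = emeasure Z B"
    by (simp add: distr_b0[OF g] P.emeasure_pair_measure_alt[OF B'] Z_eq)
  finally show "emeasure (distr Z Z (T g)) B = emeasure Z B" .
qed simp

end

section \<open>Returns along moving representatives\<close>

lemma (in prob_space) finite_subcover_up_to:
  assumes A: "countable A" and S: "\<And>i. i \<in> A \<Longrightarrow> S i \<in> events"
    and cover: "AE x in M. \<exists>i\<in>A. x \<in> S i" and e: "0 < e"
  obtains K where "finite K" "K \<subseteq> A" "prob {x \<in> space M. \<forall>i\<in>K. x \<notin> S i} < e"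
proof -
  \<comment> \<open>The finite initial parts of an enumeration exhaust the index set.\<close>
  define K where "K n = {i \<in> A. to_nat_on A i < n}" for n
  have K: "finite (K n)" "K n \<subseteq> A" for n
  proof -
    have "inj_on (to_nat_on A) (K n)"
      using inj_on_to_nat_on[OF A] by (rule inj_on_subset) (auto simp: K_def)
    moreover have "finite (to_nat_on A ` K n)"
      by (rule finite_subset[of _ "{..<n}"]) (auto simp: K_def)
    ultimately show "finite (K n)" by (rule finite_imageD[rotated])
  qed (auto simp: K_def)
  define R where "R n = {x \<in> space M. \<forall>i\<in>K n. x \<notin> S i}" for n
  have R: "R n \<in> events" for n
  proof -
    have "space M - (\<Union>i\<in>K n. S i) \<in> events"
      by (intro sets.Diff sets.top sets.finite_UN K(1) S subsetD[OF K(2)])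
    also have "space M - (\<Union>i\<in>K n. S i) = R n" by (auto simp: R_def)
    finally show ?thesis .
  qed
  have "(\<lambda>n. prob (R n)) \<longlonglongrightarrow> prob (\<Inter>n. R n)"
    using R by (intro finite_Lim_measure_decseq) (auto simp: decseq_def R_def K_def)
  moreover have "prob (\<Inter>n. R n) = 0"
  proof (rule measure_eq_0_null_sets, rule AE_iff_null_sets[THEN iffD2])
    show "(\<Inter>n. R n) \<in> events" using R by auto
    have "x \<notin> (\<Inter>n. R n)" if ex: "\<exists>i\<in>A. x \<in> S i" for x
    proof -
      obtain i where "i \<in> A" "x \<in> S i" using ex by blast
      then have "x \<notin> R (Suc (to_nat_on A i))" by (auto simp: R_def K_def)
      then show ?thesis by blast
    qed
    then show "AE x in M. x \<notin> (\<Inter>n. R n)" using cover by (auto elim!: AE_mp)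
  qed
  ultimately have "(\<lambda>n. prob (R n)) \<longlonglongrightarrow> 0" by simp
  then have "\<forall>\<^sub>F n in sequentially. prob (R n) < e" using e by (rule order_tendstoD)
  then obtain n where "prob (R n) < e" by (auto dest: eventually_happens)
  then show ?thesis using that[of "K n"] K by (simp add: R_def)
qed

lemma eventually_group_infinity:
  "eventually Q (group_infinity H) \<longleftrightarrow> finite {h \<in> carrier H. \<not> Q h}"
  unfolding group_infinity_def eventually_inf_principal eventually_cofinite
  by (rule arg_cong[where f = finite]) auto

lemma eventually_in_carrier: "\<forall>\<^sub>F h in group_infinity H. h \<in> carrier H"
  by (simp add: eventually_group_infinity)

text \<open>Two-sided translation is injective, so it pulls finite sets back to finite sets.\<close>

lemma (in group) filterlim_translate_group_infinity:
  assumes "a \<in> carrier G" "b \<in> carrier G"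
  shows "filterlim (\<lambda>g. a \<otimes> g \<otimes> b) (group_infinity G) (group_infinity G)"
  unfolding filterlim_iff eventually_group_infinity
proof safe
  fix Q assume fin: "finite {g \<in> carrier G. \<not> Q g}"
  show "finite {g \<in> carrier G. \<not> Q (a \<otimes> g \<otimes> b)}"
  proof (rule inj_on_finite[OF _ _ fin])
    show "inj_on (\<lambda>g. a \<otimes> g \<otimes> b) {g \<in> carrier G. \<not> Q (a \<otimes> g \<otimes> b)}"
      using assms by (auto intro!: inj_onI)
  qed (use assms in auto)
qed

context coinduction
begin

text \<open>The event that source coordinate \<open>i\<close> feeds target coordinate \<open>j\<close> under \<open>g\<close>: the only obstruction
  to independence of the fibre coordinates.\<close>

definition meeting :: "nat \<Rightarrow> nat \<Rightarrow> 'g \<Rightarrow> 'x set" where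
  "meeting i j g = {x \<in> space X. (C i x, C j (b0 g x)) \<in> E}"

lemma meeting_sets: "i \<in> I \<Longrightarrow> j \<in> I \<Longrightarrow> g \<in> carrier G \<Longrightarrow> meeting i j g \<in> sets X"
  unfolding meeting_def
  using pred_E[OF C_measurable[of i] measurable_compose[OF b0_measurable[of g] C_measurable[of j]]]
  by (simp add: pred_def)

lemma in_meeting_iff:
  assumes x: "good x" "x \<in> space X" and g: "g \<in> carrier G" and ij: "i \<in> I" "j \<in> I"
  shows "x \<in> meeting i j g \<longleftrightarrow> \<kappa> g x j = i"
proof
  assume "x \<in> meeting i j g"
  then obtain d where "d \<in> carrier D" "a0 d (C i x) = C j (b0 g x)"
    by (auto simp: meeting_def E_iff)
  then show "\<kappa> g x j = i" using cocycle_unique[OF x g ij(2,1)] by blast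
next
  assume i: "\<kappa> g x j = i"
  then show "x \<in> meeting i j g"
    using cocycle_spec(2,3)[OF x g ij(2)] x ij(1) unfolding meeting_def E_iff i[symmetric] 
    by (metis (mono_tags, lifting) C_space i mem_Collect_eq)
qed

text \<open>Substituting \<open>w = b0 \<alpha> x\<close>, which preserves the measure, turns meeting along two fixed translates
  into returning to the \<open>E\<close>-class under one group element.\<close>

lemma measure_orbit_meeting:
  assumes g: "g \<in> carrier G" and ab: "\<alpha> \<in> carrier G" "\<beta> \<in> carrier G"
  shows "{x \<in> space X. (b0 \<alpha> x, b0 \<beta> (b0 g x)) \<in> E} \<in> sets X"
    and "measure X {x \<in> space X. (b0 \<alpha> x, b0 \<beta> (b0 g x)) \<in> E} =
      return_measure X E b0 (\<beta> \<otimes>\<^bsub>G\<^esub> g \<otimes>\<^bsub>G\<^esub> inv\<^bsub>G\<^esub> \<alpha>)"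
proof -
  let ?h = "\<beta> \<otimes>\<^bsub>G\<^esub> g \<otimes>\<^bsub>G\<^esub> inv\<^bsub>G\<^esub> \<alpha>"
  let ?R = "{w \<in> space X. (b0 ?h w, w) \<in> E}"
  have h: "?h \<in> carrier G" using g ab by simp
  have R: "?R \<in> sets X"
    using pred_E[OF b0_measurable[OF h] measurable_ident] by (simp add: pred_def)
  have "b0 ?h (b0 \<alpha> x) = b0 \<beta> (b0 g x)" if "x \<in> space X" for x
    using that g ab b0.orbit_sym_aux[OF ab(1) that refl] by (simp add: b0.composition_rule)
  moreover have "(u, v) \<in> E \<longleftrightarrow> (v, u) \<in> E" for u v
    using equiv_E by (auto simp: equiv_def sym_def)
  ultimately have *: "{x \<in> space X. (b0 \<alpha> x, b0 \<beta> (b0 g x)) \<in> E} = b0 \<alpha> -` ?R \<inter> space X"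
    using ab by auto
  show "{x \<in> space X. (b0 \<alpha> x, b0 \<beta> (b0 g x)) \<in> E} \<in> sets X"
    unfolding * using b0_measurable[OF ab(1)] R by (rule measurable_sets)
  show "measure X {x \<in> space X. (b0 \<alpha> x, b0 \<beta> (b0 g x)) \<in> E} = return_measure X E b0 ?h"
    unfolding * return_measure_def
    using measure_distr[OF b0_measurable[OF ab(1)] R] distr_b0[OF ab(1)] by simp
qed

text \<open>A choice function moves each point within its orbit, so up to a small set it agrees pointwise with
  one of finitely many elements of the group.\<close>

lemma choice_orbit_cover:
  assumes i: "i \<in> I" and e: "0 < (e::real)"
  obtains K where "finite K" "K \<subseteq> carrier G"
    "{x \<in> space X. \<forall>g\<in>K. C i x \<noteq> b0 g x} \<in> sets X"
    "measure X {x \<in> space X. \<forall>g\<in>K. C i x \<noteq> b0 g x} < e"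
proof -
  define S where "S g = {x \<in> space X. C i x = b0 g x}" for g
  have S: "S g \<in> sets X" if "g \<in> carrier G" for g
    using pred_eq[OF C_measurable[OF i] b0_measurable[OF that]] by (simp add: S_def pred_def)
  have "\<exists>g\<in>carrier G. x \<in> S g" if "good x" "x \<in> space X" for x
    using goodD(4)[OF that i] that(2) by (auto simp: S_def F_iff)
  then have cover: "AE x in X. \<exists>g\<in>carrier G. x \<in> S g" using AE_good by (auto elim!: AE_mp)
  obtain K where K: "finite K" "K \<subseteq> carrier G" "measure X {x \<in> space X. \<forall>g\<in>K. x \<notin> S g} < e"
    by (rule X.finite_subcover_up_to[OF countable_G S cover e])
  have eq: "{x \<in> space X. \<forall>g\<in>K. x \<notin> S g} = {x \<in> space X. \<forall>g\<in>K. C i x \<noteq> b0 g x}"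
    by (auto simp: S_def)
  have "space X - (\<Union>g\<in>K. S g) \<in> sets X"
    by (intro sets.Diff sets.top sets.finite_UN K(1) S subsetD[OF K(2)])
  also have "space X - (\<Union>g\<in>K. S g) = {x \<in> space X. \<forall>g\<in>K. x \<notin> S g}" by auto
  finally have "{x \<in> space X. \<forall>g\<in>K. x \<notin> S g} \<in> sets X" .
  then show ?thesis using that K unfolding eq by blast
qed

text \<open>Outside a small set, \<open>C i\<close> acts by elements \<open>\<alpha>\<close> from a finite set and \<open>C j\<close> by elements \<open>\<beta>\<close>
  from a finite set. What remains of the meeting event is a finite union of return events for
  \<open>\<beta> \<otimes> g \<otimes> inv \<alpha>\<close>, and these group elements tend to infinity with \<open>g\<close>.\<close>

lemma meeting_tendsto_0:
  assumes lim: "(return_measure X E b0 \<longlongrightarrow> 0) (group_infinity G)" and ij: "i \<in> I" "j \<in> I"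
  shows "((\<lambda>g. measure X (meeting i j g)) \<longlongrightarrow> 0) (group_infinity G)"
proof (rule tendstoI)
  fix e :: real assume "0 < e"
  then have e3: "0 < e / 3" by simp
  obtain K where K: "finite K" "K \<subseteq> carrier G"
    "{x \<in> space X. \<forall>g\<in>K. C i x \<noteq> b0 g x} \<in> sets X"
    "measure X {x \<in> space X. \<forall>g\<in>K. C i x \<noteq> b0 g x} < e / 3"
    using choice_orbit_cover[OF ij(1) e3] .
  obtain L where L: "finite L" "L \<subseteq> carrier G"
    "{x \<in> space X. \<forall>g\<in>L. C j x \<noteq> b0 g x} \<in> sets X"
    "measure X {x \<in> space X. \<forall>g\<in>L. C j x \<noteq> b0 g x} < e / 3"
    using choice_orbit_cover[OF ij(2) e3] .
  let ?KX = "{x \<in> space X. \<forall>g\<in>K. C i x \<noteq> b0 g x}" and ?LX = "{x \<in> space X. \<forall>g\<in>L. C j x \<noteq> b0 g x}"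
  let ?r = "\<lambda>g. \<Sum>\<alpha>\<in>K. \<Sum>\<beta>\<in>L. return_measure X E b0 (\<beta> \<otimes>\<^bsub>G\<^esub> g \<otimes>\<^bsub>G\<^esub> inv\<^bsub>G\<^esub> \<alpha>)"
  have "(?r \<longlongrightarrow> 0) (group_infinity G)"
    using K(2) L(2)
    by (intro tendsto_null_sum filterlim_compose[OF lim] G.filterlim_translate_group_infinity) auto
  then have "\<forall>\<^sub>F g in group_infinity G. ?r g < e / 3" using e3 by (rule order_tendstoD)
  with eventually_in_carrier show "\<forall>\<^sub>F g in group_infinity G. dist (measure X (meeting i j g)) 0 < e"
  proof eventually_elim
    case (elim g)
    let ?M = "\<lambda>\<alpha> \<beta>. {x \<in> space X. (b0 \<alpha> x, b0 \<beta> (b0 g x)) \<in> E}"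
    have M: "?M \<alpha> \<beta> \<in> sets X" "measure X (?M \<alpha> \<beta>) = return_measure X E b0 (\<beta> \<otimes>\<^bsub>G\<^esub> g \<otimes>\<^bsub>G\<^esub> inv\<^bsub>G\<^esub> \<alpha>)"
      if "\<alpha> \<in> K" "\<beta> \<in> L" for \<alpha> \<beta>
      using measure_orbit_meeting[OF elim(1) subsetD[OF K(2) that(1)] subsetD[OF L(2) that(2)]] by auto
    let ?U = "\<Union>\<alpha>\<in>K. \<Union>\<beta>\<in>L. ?M \<alpha> \<beta>"
    have gL: "b0 g -` ?LX \<inter> space X \<in> sets X" "measure X (b0 g -` ?LX \<inter> space X) = measure X ?LX"
      using measurable_sets[OF b0_measurable[OF elim(1)] L(3)]
        measure_distr[OF b0_measurable[OF elim(1)] L(3)] distr_b0[OF elim(1)] by auto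
    have U: "?U \<in> sets X" using M K L by (intro sets.finite_UN) auto
    have "meeting i j g \<subseteq> ?KX \<union> ((b0 g -` ?LX \<inter> space X) \<union> ?U)"
      using elim(1) by (fastforce simp: meeting_def)
    then have "measure X (meeting i j g) \<le> measure X (?KX \<union> ((b0 g -` ?LX \<inter> space X) \<union> ?U))"
      using K(3) gL U by (intro X.finite_measure_mono) auto
    also have "\<dots> \<le> measure X ?KX + (measure X (b0 g -` ?LX \<inter> space X) + measure X ?U)"
      using K(3) gL U by (intro order_trans[OF measure_Un_le add_left_mono[OF measure_Un_le]]) auto
    also have "measure X ?U \<le> (\<Sum>\<alpha>\<in>K. measure X (\<Union>\<beta>\<in>L. ?M \<alpha> \<beta>))"
      using K L M by (intro X.finite_measure_subadditive_finite) auto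
    also have "\<dots> \<le> (\<Sum>\<alpha>\<in>K. \<Sum>\<beta>\<in>L. measure X (?M \<alpha> \<beta>))"
      using L M by (intro sum_mono X.finite_measure_subadditive_finite) auto
    also have "\<dots> = ?r g" using M by (intro sum.cong) auto
    finally show ?case using K(4) L(4) gL(2) elim(2) by simp
  qed
qed

end

section \<open>Slices and correlations of rectangles\<close>

lemma measure_pair_measure_slices:
  assumes "finite_measure M" and "prob_space P" and S: "S \<in> sets (M \<Otimes>\<^sub>M P)"
  shows "integrable M (\<lambda>x. measure P (Pair x -` S))"
    and "measure (M \<Otimes>\<^sub>M P) S = (\<integral>x. measure P (Pair x -` S) \<partial>M)"
proof -
  interpret M: finite_measure M by fact
  interpret P: prob_space P by fact
  have m: "(\<lambda>x. measure P (Pair x -` S)) \<in> borel_measurable M"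
    using P.measurable_emeasure_Pair[OF S] unfolding measure_def by measurable
  then show int: "integrable M (\<lambda>x. measure P (Pair x -` S))"
    by (intro M.integrable_const_bound[where B = 1]) auto
  have "emeasure (M \<Otimes>\<^sub>M P) S = (\<integral>\<^sup>+x. ennreal (measure P (Pair x -` S)) \<partial>M)"
    unfolding P.emeasure_pair_measure_alt[OF S] P.emeasure_eq_measure ..
  also have "\<dots> = ennreal (\<integral>x. measure P (Pair x -` S) \<partial>M)"
    using int by (rule nn_integral_eq_integral) simp
  finally show "measure (M \<Otimes>\<^sub>M P) S = (\<integral>x. measure P (Pair x -` S) \<partial>M)"
    by (rule measure_eq_emeasure_eq_ennreal[OF integral_nonneg_AE, rotated]) simp
qed

text \<open>If the slices of \<open>S\<close> have the constant measure \<open>c\<close> over \<open>Q\<close> and are null elsewhere, except over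
  \<open>R\<close>, then the slice measure differs from \<open>c\<close> times the indicator of \<open>Q\<close> by at most the indicator
  of \<open>R\<close>, because both terms lie between \<open>0\<close> and \<open>1\<close>.\<close>

lemma measure_pair_measure_approx:
  assumes M: "prob_space M" and P: "prob_space P" and S: "S \<in> sets (M \<Otimes>\<^sub>M P)"
    and Q: "Q \<in> sets M" and R: "R \<in> sets M" and c: "0 \<le> c" "c \<le> 1"
    and slice: "AE x in M. x \<notin> R \<longrightarrow> measure P (Pair x -` S) = c * indicator Q x"
  shows "\<bar>measure (M \<Otimes>\<^sub>M P) S - c * measure M Q\<bar> \<le> measure M R"
proof -
  interpret M: prob_space M by fact
  interpret P: prob_space P by fact
  note f = measure_pair_measure_slices[OF M.finite_measure_axioms P S]
  have Q': "integrable M (\<lambda>x. c * indicator Q x)" using Q by (simp add: M.emeasure_eq_measure)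
  have R': "integrable M (\<lambda>x. indicator R x :: real)" using R by (simp add: M.emeasure_eq_measure)
  have "measure (M \<Otimes>\<^sub>M P) S - c * measure M Q =
      (\<integral>x. measure P (Pair x -` S) - c * indicator Q x \<partial>M)"
    using f Q Q' by simp
  also have "\<bar>\<dots>\<bar> \<le> (\<integral>x. \<bar>measure P (Pair x -` S) - c * indicator Q x\<bar> \<partial>M)"
    by (rule integral_abs_bound)
  also have "\<dots> \<le> (\<integral>x. indicator R x \<partial>M)"
  proof (rule integral_mono_AE)
    have "\<bar>measure P (Pair x -` S) - c * indicator Q x\<bar> \<le> 1" for x
    proof -
      have "0 \<le> c * indicator Q x" "c * indicator Q x \<le> 1" using c by (auto simp: indicator_def)
      then show ?thesis using P.prob_le_1[of "Pair x -` S"] measure_nonneg[of P "Pair x -` S"]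
        by linarith
    qed
    then show "AE x in M. \<bar>measure P (Pair x -` S) - c * indicator Q x\<bar> \<le> indicator R x"
      using slice by (auto elim!: AE_mp simp: indicator_def)
  qed (use f Q' R' in auto)
  finally show ?thesis using R by simp
qed

context coinduced_action
begin

lemma slice_cylinders:
  assumes x: "good x" "x \<in> space X" and g: "g \<in> carrier G"
    and J: "finite J" "J \<subseteq> I" "\<And>i. i \<in> J \<Longrightarrow> V i \<in> sets Y"
    and K: "finite K" "K \<subseteq> I" "\<And>i. i \<in> K \<Longrightarrow> W i \<in> sets Y"
    and disj: "\<kappa> g x ` K \<inter> J = {}"
  shows "measure P {y\<in>space P. (\<forall>i\<in>J. y i \<in> V i) \<and> (\<forall>j\<in>K. fibre_map g x y j \<in> W j)} =
    (\<Prod>i\<in>J. measure Y (V i)) * (\<Prod>j\<in>K. measure Y (W j))"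
  using fibre_rectangle[OF assms]
  by (simp add: P.emeasure_eq_measure Y.emeasure_eq_measure prod_ennreal prod_nonneg
      ennreal_mult[symmetric])

lemma measure_cylinder:
  assumes J: "finite J" "J \<subseteq> I" "\<And>i. i \<in> J \<Longrightarrow> V i \<in> sets Y"
  shows "{y\<in>space P. \<forall>i\<in>J. y i \<in> V i} \<in> sets P"
    and "measure P {y\<in>space P. \<forall>i\<in>J. y i \<in> V i} = (\<Prod>i\<in>J. measure Y (V i))"
proof -
  show "{y\<in>space P. \<forall>i\<in>J. y i \<in> V i} \<in> sets P"
    using J by (auto simp: subset_eq)
  show "measure P {y\<in>space P. \<forall>i\<in>J. y i \<in> V i} = (\<Prod>i\<in>J. measure Y (V i))"
    using P.emeasure_PiM_Collect[OF J(2,1,3)]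
    by (simp add: P.emeasure_eq_measure Y.emeasure_eq_measure prod_ennreal prod_nonneg)
qed

lemma slice_rectangle:
  assumes x: "good x" "x \<in> space X" and g: "g \<in> carrier G" and K: "K \<subseteq> I"
  shows "Pair x -` {z \<in> A0 \<times> {y\<in>space P. \<forall>i\<in>J. y i \<in> V i}. T g z \<in> B0 \<times> {y\<in>space P. \<forall>j\<in>K. y j \<in> W j}} =
    (if x \<in> A0 \<and> b0 g x \<in> B0
     then {y\<in>space P. (\<forall>i\<in>J. y i \<in> V i) \<and> (\<forall>j\<in>K. fibre_map g x y j \<in> W j)} else {})"
  using x fibre_map_space[OF x g] by (auto simp: T_eq)

lemma correlation_sets:
  assumes "g \<in> carrier G" "A \<in> sets Z" "B \<in> sets Z"
  shows "{z \<in> A. T g z \<in> B} \<in> sets Z"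
proof -
  have "{z \<in> A. T g z \<in> B} = A \<inter> (T g -` B \<inter> space Z)"
    using sets.sets_into_space[OF assms(2)] by auto
  then show ?thesis using assms measurable_sets[OF T_measurable] by simp
qed

text \<open>Off the meeting events the source coordinates \<open>\<kappa> g x ` K\<close> avoid \<open>J\<close>, so each slice
  over a point that satisfies both base conditions has the product measure; the correlation in the
  base is then the only dependence on \<open>g\<close> that is left.\<close>

lemma correlation_rectangles:
  assumes g: "g \<in> carrier G" and A0: "A0 \<in> sets X" and B0: "B0 \<in> sets X"
    and J: "finite J" "J \<subseteq> I" "\<And>i. i \<in> J \<Longrightarrow> V i \<in> sets Y"
    and K: "finite K" "K \<subseteq> I" "\<And>i. i \<in> K \<Longrightarrow> W i \<in> sets Y"
  shows "\<bar>measure Z {z \<in> A0 \<times> {y\<in>space P. \<forall>i\<in>J. y i \<in> V i}. T g z \<in> B0 \<times> {y\<in>space P. \<forall>j\<in>K. y j \<in> W j}}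
      - (\<Prod>i\<in>J. measure Y (V i)) * (\<Prod>j\<in>K. measure Y (W j)) * measure X {x \<in> A0. b0 g x \<in> B0}\<bar>
    \<le> (\<Sum>i\<in>J. \<Sum>j\<in>K. measure X (meeting i j g))"
proof -
  let ?S = "{z \<in> A0 \<times> {y\<in>space P. \<forall>i\<in>J. y i \<in> V i}. T g z \<in> B0 \<times> {y\<in>space P. \<forall>j\<in>K. y j \<in> W j}}"
  let ?Q = "{x \<in> A0. b0 g x \<in> B0}"
  let ?R = "\<Union>i\<in>J. \<Union>j\<in>K. meeting i j g"
  let ?c = "(\<Prod>i\<in>J. measure Y (V i)) * (\<Prod>j\<in>K. measure Y (W j))"
  have S: "?S \<in> sets Z"
    using measure_cylinder(1)[OF J] measure_cylinder(1)[OF K] A0 B0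
    by (intro correlation_sets g) (auto simp: Z_eq)
  have "?Q = A0 \<inter> (b0 g -` B0 \<inter> space X)" using sets.sets_into_space[OF A0] by auto
  then have Q: "?Q \<in> sets X" using A0 measurable_sets[OF b0_measurable[OF g] B0] by simp
  have R: "?R \<in> sets X" using J K g by (intro sets.finite_UN meeting_sets) auto
  have c: "0 \<le> ?c" "?c \<le> 1"
    by (auto intro!: mult_nonneg_nonneg prod_nonneg mult_le_one prod_le_1)
  have slice: "measure P (Pair x -` ?S) = ?c * indicator ?Q x"
    if x: "good x" "x \<in> space X" and "x \<notin> ?R" for x
  proof -
    have "\<kappa> g x ` K \<inter> J = {}"
      using \<open>x \<notin> ?R\<close> in_meeting_iff[OF x g subsetD[OF J(2)] subsetD[OF K(2)]] by auto
    then show ?thesis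
      unfolding slice_rectangle[OF x g K(2)]
      using slice_cylinders[OF x g J K] by (simp add: indicator_def)
  qed
  have "AE x in X. x \<notin> ?R \<longrightarrow> measure P (Pair x -` ?S) = ?c * indicator ?Q x"
    using AE_good slice by (auto elim!: AE_mp)
  then have "\<bar>measure Z ?S - ?c * measure X ?Q\<bar> \<le> measure X ?R"
    unfolding Z_eq
    by (intro measure_pair_measure_approx X.prob_space_axioms P.prob_space_axioms S[unfolded Z_eq] Q R c)
  also have "\<dots> \<le> (\<Sum>i\<in>J. measure X (\<Union>j\<in>K. meeting i j g))"
    using J K g by (intro X.finite_measure_subadditive_finite) (auto intro!: meeting_sets)
  also have "\<dots> \<le> (\<Sum>i\<in>J. \<Sum>j\<in>K. measure X (meeting i j g))"
    using J K g by (intro sum_mono X.finite_measure_subadditive_finite) (auto intro!: meeting_sets)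
  finally show ?thesis .
qed

end

section \<open>Mixing of the co-induced action\<close>

context coinduced_action
begin

lemma measure_b0_image:
  assumes g: "g \<in> carrier G" and A: "A \<in> sets X" and B: "B \<in> sets X"
  shows "measure X (b0 g ` A \<inter> B) = measure X {x \<in> A. b0 g x \<in> B}"
proof (rule X.prob_image_Int[OF b0_measurable[OF g] distr_b0[OF g] b0_measurable[OF G.inv_closed[OF g]] _ _ A B])
  fix x assume x: "x \<in> space X"
  show "b0 (inv\<^bsub>G\<^esub> g) (b0 g x) = x" using b0.orbit_sym_aux[OF g x] by blast
  show "b0 g (b0 (inv\<^bsub>G\<^esub> g) x) = x" using b0.orbit_sym_aux[OF G.inv_closed[OF g] x] g by simp
qed

lemma measure_T_image:
  assumes g: "g \<in> carrier G" and A: "A \<in> sets Z" and B: "B \<in> sets Z"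
  shows "measure Z (T g ` A \<inter> B) = measure Z {z \<in> A. T g z \<in> B}"
proof (rule Z.prob_image_Int[OF T_measurable[OF g] distr_T[OF g] T_measurable[OF G.inv_closed[OF g]] _ _ A B])
  fix z assume z: "z \<in> space Z"
  show "T (inv\<^bsub>G\<^esub> g) (T g z) = z"
    using T_mult[OF z G.inv_closed[OF g] g] T_one[OF z] g by simp
  show "T g (T (inv\<^bsub>G\<^esub> g) z) = z"
    using T_mult[OF z g G.inv_closed[OF g]] T_one[OF z] g by simp
qed

lemma mixing_T_iff:
  "mixing G Z T \<longleftrightarrow> (\<forall>A\<in>sets Z. \<forall>B\<in>sets Z.
    ((\<lambda>g. measure Z {z \<in> A. T g z \<in> B}) \<longlongrightarrow> measure Z A * measure Z B) (group_infinity G))"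
proof -
  have "((\<lambda>g. measure Z (T g ` A \<inter> B)) \<longlongrightarrow> c) (group_infinity G) \<longleftrightarrow>
      ((\<lambda>g. measure Z {z \<in> A. T g z \<in> B}) \<longlongrightarrow> c) (group_infinity G)"
    if "A \<in> sets Z" "B \<in> sets Z" for A B c
    using eventually_in_carrier[of G]
    by (intro tendsto_cong) (auto elim!: eventually_mono simp: measure_T_image that)
  then show ?thesis by (simp add: mixing_def)
qed

lemma measure_Z_Times:
  assumes "A \<in> sets X" "B \<in> sets P"
  shows "measure Z (A \<times> B) = measure X A * measure P B"
  unfolding Z_eq measure_def P.emeasure_pair_measure_Times[OF assms] enn2real_mult ..

definition rectangles :: "('x \<times> (nat \<Rightarrow> 'y)) set set" where
  "rectangles = {A \<times> B | A B. A \<in> sets X \<and> B \<in> prod_algebra I (\<lambda>_. Y)}"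

lemma rectanglesE:
  assumes "R \<in> rectangles"
  obtains A J V where "R = A \<times> {y\<in>space P. \<forall>i\<in>J. y i \<in> V i}"
    "A \<in> sets X" "finite J" "J \<subseteq> I" "\<And>i. i \<in> J \<Longrightarrow> V i \<in> sets Y"
proof -
  obtain A B where AB: "R = A \<times> B" "A \<in> sets X" "B \<in> prod_algebra I (\<lambda>_. Y)"
    using assms by (auto simp: rectangles_def)
  obtain J V where J: "B = prod_emb I (\<lambda>_. Y) J (\<Pi>\<^sub>E j\<in>J. V j)" "finite J" "J \<subseteq> I"
    "\<And>i. i \<in> J \<Longrightarrow> V i \<in> sets Y"
    using AB(3) by (rule prod_algebraE) (rule that; simp)
  have "B = {y\<in>space P. \<forall>i\<in>J. y i \<in> V i}"
    using J(3) unfolding J(1) by (auto simp: prod_emb_def space_PiM PiE_iff extensional_def)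
  then show ?thesis using that AB J by blast
qed

lemma rectangles:
  shows "Int_stable rectangles" "rectangles \<subseteq> Pow (space Z)"
    "sets Z = sigma_sets (space Z) rectangles" "space Z \<in> rectangles"
proof -
  have alg: "prod_algebra I (\<lambda>_. Y) \<subseteq> Pow (space P)"
    using prod_algebra_sets_into_space[of I "\<lambda>_. Y"] by (simp add: space_PiM)
  have top: "space P \<in> prod_algebra I (\<lambda>_. Y)"
    using space_in_prod_algebra[of I "\<lambda>_. Y"] by (simp add: space_PiM)
  show sub: "rectangles \<subseteq> Pow (space Z)"
    using alg sets.sets_into_space by (fastforce simp: rectangles_def Z_eq space_pair_measure)
  show "space Z \<in> rectangles"
    using top sets.top by (auto simp: rectangles_def Z_eq space_pair_measure)
  show "Int_stable rectangles"
  proof (rule Int_stableI)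
    fix a b assume "a \<in> rectangles" "b \<in> rectangles"
    then obtain A B A' B' where "a = A \<times> B" "b = A' \<times> B'" "A \<in> sets X" "A' \<in> sets X"
      "B \<in> prod_algebra I (\<lambda>_. Y)" "B' \<in> prod_algebra I (\<lambda>_. Y)"
      by (auto simp: rectangles_def)
    moreover from this have "B \<inter> B' \<in> prod_algebra I (\<lambda>_. Y)"
      using Int_stable_prod_algebra by (auto simp: Int_stable_def)
    ultimately show "a \<inter> b \<in> rectangles" by (auto simp: rectangles_def Times_Int_Times)
  qed
  have "sets (X \<Otimes>\<^sub>M P) = sets (sigma (space X) (sets X) \<Otimes>\<^sub>M sigma (space P) (prod_algebra I (\<lambda>_. Y)))"
    using alg by (intro sets_pair_measure_cong)
      (auto simp: sets.space_closed sets_measure_of sets.sigma_sets_eq sets_PiM space_PiM)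
  also have "\<dots> = sets (sigma (space X \<times> space P) rectangles)"
    unfolding rectangles_def
  proof (intro arg_cong[where f = sets] sigma_prod alg sets.space_closed)
    show "\<exists>E\<subseteq>sets X. countable E \<and> space X = \<Union>E" by (intro exI[of _ "{space X}"]) auto
    show "\<exists>E\<subseteq>prod_algebra I (\<lambda>_. Y). countable E \<and> space P = \<Union>E"
      using top by (intro exI[of _ "{space P}"]) auto
  qed
  finally show "sets Z = sigma_sets (space Z) rectangles"
    using sub by (simp add: Z_eq space_pair_measure sets_measure_of)
qed

text \<open>For rectangles the correlation differs from a constant multiple of a correlation of \<open>b0\<close> by a
  finite sum of measures of meeting events, which vanishes in the limit. Rectangles form a
  generating \<open>\<pi>\<close>-system.\<close>

lemma mixing_T:
  assumes mix: "mixing G X b0" and lim: "(return_measure X E b0 \<longlongrightarrow> 0) (group_infinity G)"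
  shows "mixing G Z T"
  unfolding mixing_T_iff
proof (rule ballI, rule ballI, rule Z.correlation_tendsto_from_generator[OF rectangles])
  show "\<forall>\<^sub>F g in group_infinity G. T g \<in> Z \<rightarrow>\<^sub>M Z \<and> distr Z Z (T g) = Z"
    using eventually_in_carrier[of G] by eventually_elim (use T_measurable distr_T in blast)
next
  fix A B assume "A \<in> rectangles" "B \<in> rectangles"
  obtain A0 J V where A: "A = A0 \<times> {y\<in>space P. \<forall>i\<in>J. y i \<in> V i}" "A0 \<in> sets X"
    and J: "finite J" "J \<subseteq> I" "\<And>i. i \<in> J \<Longrightarrow> V i \<in> sets Y"
    using \<open>A \<in> rectangles\<close> by (rule rectanglesE) (rule that; simp)
  obtain B0 K W where B: "B = B0 \<times> {y\<in>space P. \<forall>i\<in>K. y i \<in> W i}" "B0 \<in> sets X"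
    and K: "finite K" "K \<subseteq> I" "\<And>i. i \<in> K \<Longrightarrow> W i \<in> sets Y"
    using \<open>B \<in> rectangles\<close> by (rule rectanglesE) (rule that; simp)
  let ?c = "(\<Prod>i\<in>J. measure Y (V i)) * (\<Prod>j\<in>K. measure Y (W j))"
  let ?q = "\<lambda>g. measure X {x \<in> A0. b0 g x \<in> B0}"
  let ?f = "\<lambda>g. measure Z {z \<in> A. T g z \<in> B}"
  have "((\<lambda>g. measure X (b0 g ` A0 \<inter> B0)) \<longlongrightarrow> measure X A0 * measure X B0) (group_infinity G)"
    using mix A B by (simp add: mixing_def)
  moreover have "\<forall>\<^sub>F g in group_infinity G. measure X (b0 g ` A0 \<inter> B0) = ?q g"
    using eventually_in_carrier[of G] by eventually_elim (simp add: measure_b0_image A B)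
  ultimately have q: "(?q \<longlongrightarrow> measure X A0 * measure X B0) (group_infinity G)"
    by (rule Lim_transform_eventually)
  have "((\<lambda>g. ?f g - ?c * ?q g) \<longlongrightarrow> 0) (group_infinity G)"
  proof (rule Lim_null_comparison)
    show "\<forall>\<^sub>F g in group_infinity G. norm (?f g - ?c * ?q g) \<le>
        (\<Sum>i\<in>J. \<Sum>j\<in>K. measure X (meeting i j g))"
      using eventually_in_carrier[of G]
      by eventually_elim (use correlation_rectangles[OF _ A(2) B(2) J K] in \<open>simp add: A(1) B(1)\<close>)
    show "((\<lambda>g. \<Sum>i\<in>J. \<Sum>j\<in>K. measure X (meeting i j g)) \<longlongrightarrow> 0) (group_infinity G)"
      using J K by (intro tendsto_null_sum meeting_tendsto_0 lim) auto
  qed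
  from tendsto_add[OF this tendsto_mult[OF tendsto_const[of ?c] q]]
  have "(?f \<longlongrightarrow> ?c * (measure X A0 * measure X B0)) (group_infinity G)" by simp
  also have "?c * (measure X A0 * measure X B0) = measure Z A * measure Z B"
    using measure_Z_Times[OF A(2) measure_cylinder(1)[of J V, OF J]]
      measure_Z_Times[OF B(2) measure_cylinder(1)[of K W, OF K]]
    by (simp add: A(1) B(1) measure_cylinder(2)[of J V, OF J] measure_cylinder(2)[of K W, OF K] mult_ac)
  finally show "(?f \<longlongrightarrow> measure Z A * measure Z B) (group_infinity G)" .
qed

text \<open>When the fibre action is trivial, the cylinder over \<open>H\<close> in coordinate \<open>0\<close> detects returns: since
  \<open>C 0\<close> is the identity, coordinate \<open>0\<close> is kept where \<open>g\<close> returns to the \<open>E\<close>-class, and there the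
  slice has measure \<open>measure Y H\<close>; elsewhere coordinate \<open>0\<close> is replaced by an independent one, and
  the slice has the square of this measure.\<close>

lemma correlation_trivial_fibre:
  assumes triv: "\<And>d y. d \<in> carrier D \<Longrightarrow> y \<in> space Y \<Longrightarrow> a d y = y"
    and H: "H \<in> sets Y" and g: "g \<in> carrier G"
  defines "A \<equiv> space X \<times> {y\<in>space P. y 0 \<in> H}"
  shows "measure Z {z \<in> A. T g z \<in> A} =
    (measure Y H)\<^sup>2 + (measure Y H - (measure Y H)\<^sup>2) * return_measure X E b0 g"
proof -
  let ?m = "measure Y H"
  let ?Q = "{x \<in> space X. (b0 g x, x) \<in> E}"
  let ?S = "{z \<in> A. T g z \<in> A}"
  have z: "{0} \<subseteq> I" "finite {0::nat}" using zero_in_index by auto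
  have Aeq: "A = space X \<times> {y\<in>space P. \<forall>i\<in>{0}. y i \<in> (\<lambda>_. H) i}" by (simp add: A_def)
  have "A \<in> sets Z"
    unfolding Aeq Z_eq using measure_cylinder(1)[OF z(2,1), of "\<lambda>_. H"] H by (intro pair_measureI) auto
  then have S: "?S \<in> sets (X \<Otimes>\<^sub>M P)" using correlation_sets[OF g] by (simp add: Z_eq)
  have Q: "?Q \<in> sets X"
    using pred_E[OF b0_measurable[OF g] measurable_ident] by (simp add: pred_def)
  have slice: "measure P (Pair x -` ?S) = ?m\<^sup>2 + (?m - ?m\<^sup>2) * indicator ?Q x"
    if x: "good x" "x \<in> space X" for x
  proof -
    have gx: "b0 g x \<in> space X" using x g by simp
    have "C 0 (b0 g x) = b0 g x" "C 0 x = x"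
      using goodD(2)[OF x] goodD(2)[of "b0 g x"] x g by (auto simp: good_b0)
    then have Q_iff: "x \<in> ?Q \<longleftrightarrow> \<kappa> g x 0 = 0"
      using in_meeting_iff[OF x g zero_in_index zero_in_index] x equiv_E
      by (auto simp: meeting_def equiv_def sym_def)
    have sl: "Pair x -` ?S = {y\<in>space P. (\<forall>i\<in>{0}. y i \<in> H) \<and> (\<forall>j\<in>{0}. fibre_map g x y j \<in> H)}"
      unfolding Aeq slice_rectangle[OF x g z(1)] using x gx by simp
    show ?thesis
    proof (cases "\<kappa> g x 0 = 0")
      case True
      then have "fibre_map g x y 0 = y 0" if "y \<in> space P" for y
        using cocycle_spec[OF x g zero_in_index] that zero_in_index
        by (auto simp: fibre_map_def space_PiM intro!: triv)
      then have "Pair x -` ?S = {y\<in>space P. \<forall>i\<in>{0}. y i \<in> (\<lambda>_. H) i}" unfolding sl by auto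
      then show ?thesis
        using measure_cylinder(2)[OF z(2,1), of "\<lambda>_. H"] H True Q_iff by simp
    next
      case False
      then show ?thesis
        unfolding sl using slice_cylinders[OF x g z(2,1) _ z(2,1), of "\<lambda>_. H" "\<lambda>_. H"] H Q_iff
        by (simp add: power2_eq_square)
    qed
  qed
  have "measure Z ?S = (\<integral>x. measure P (Pair x -` ?S) \<partial>X)"
    unfolding Z_eq by (rule measure_pair_measure_slices(2)[OF X.finite_measure_axioms P.prob_space_axioms S])
  also have "\<dots> = (\<integral>x. ?m\<^sup>2 + (?m - ?m\<^sup>2) * indicator ?Q x \<partial>X)"
  proof (rule integral_cong_AE)
    show "AE x in X. measure P (Pair x -` ?S) = ?m\<^sup>2 + (?m - ?m\<^sup>2) * indicator ?Q x"
      using AE_good slice by (auto elim!: AE_mp)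
    show "(\<lambda>x. measure P (Pair x -` ?S)) \<in> borel_measurable X"
      using measure_pair_measure_slices(1)[OF X.finite_measure_axioms P.prob_space_axioms S] by simp
  qed (use Q in measurable)
  also have "\<dots> = ?m\<^sup>2 + (?m - ?m\<^sup>2) * measure X ?Q"
    using Q X.prob_space by (simp add: X.emeasure_eq_measure)
  finally show ?thesis by (simp add: return_measure_def)
qed

text \<open>Mixing drives the correlation of the cylinder over \<open>H\<close> to the square of its measure. As \<open>H\<close> has
  measure strictly between \<open>0\<close> and \<open>1\<close>, the coefficient of the return measure in this correlation
  is positive, so that the return measure must vanish.\<close>

lemma return_measure_tendsto_0:
  assumes mix: "mixing G Z T"
    and triv: "\<And>d y. d \<in> carrier D \<Longrightarrow> y \<in> space Y \<Longrightarrow> a d y = y"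
    and H: "H \<in> sets Y" "0 < measure Y H" "measure Y H < 1"
  shows "(return_measure X E b0 \<longlongrightarrow> 0) (group_infinity G)"
proof -
  let ?m = "measure Y H"
  let ?A = "space X \<times> {y\<in>space P. y 0 \<in> H}"
  let ?f = "\<lambda>g. measure Z {z \<in> ?A. T g z \<in> ?A}"
  have z: "{0} \<subseteq> I" "finite {0::nat}" using zero_in_index by auto
  have cyl: "{y\<in>space P. y 0 \<in> H} \<in> sets P" "measure P {y\<in>space P. y 0 \<in> H} = ?m"
    using measure_cylinder[OF z(2,1), of "\<lambda>_. H"] H by simp_all
  then have A: "?A \<in> sets Z" "measure Z ?A = ?m"
    using measure_Z_Times[OF sets.top cyl(1)] X.prob_space by (simp_all add: Z_eq)
  have pos: "0 < ?m - ?m\<^sup>2" using H by (simp add: power2_eq_square)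
  have "(?f \<longlongrightarrow> ?m\<^sup>2) (group_infinity G)"
    using mix[unfolded mixing_T_iff, rule_format, OF A(1) A(1)] unfolding A(2) power2_eq_square .
  then have "((\<lambda>g. (?f g - ?m\<^sup>2) / (?m - ?m\<^sup>2)) \<longlongrightarrow> (?m\<^sup>2 - ?m\<^sup>2) / (?m - ?m\<^sup>2)) (group_infinity G)"
    using pos by (intro tendsto_intros) auto
  moreover have "\<forall>\<^sub>F g in group_infinity G. (?f g - ?m\<^sup>2) / (?m - ?m\<^sup>2) = return_measure X E b0 g"
    using eventually_in_carrier[of G]
    by eventually_elim (use correlation_trivial_fibre[OF triv H(1)] pos in simp)
  ultimately have "(return_measure X E b0 \<longlongrightarrow> (?m\<^sup>2 - ?m\<^sup>2) / (?m - ?m\<^sup>2)) (group_infinity G)"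
    by (rule Lim_transform_eventually)
  then show ?thesis by simp
qed

end

lemma mp_action_trivial:
  assumes "group H"
  shows "mp_action H M (\<lambda>_. \<lambda>y\<in>space M. y)"
proof -
  interpret B: group "BijGroup (space M)" by (rule group_BijGroup)
  have one: "(\<lambda>y\<in>space M. y) = \<one>\<^bsub>BijGroup (space M)\<^esub>" by (simp add: BijGroup_def)
  have "(\<lambda>_. \<lambda>y\<in>space M. y) \<in> hom H (BijGroup (space M))"
    unfolding one by (rule homI) auto
  then have "group_action H (space M) (\<lambda>_. \<lambda>y\<in>space M. y)"
    using assms by (simp add: group_action_def group_hom_def group_hom_axioms_def B.group_axioms)
  moreover have "(\<lambda>y\<in>space M. y) \<in> M \<rightarrow>\<^sub>M M"
    by (subst measurable_cong[where g = "\<lambda>y. y"]) auto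
  moreover have "distr M M (\<lambda>y\<in>space M. y) = M"
    using distr_cong[of M M M M "\<lambda>y\<in>space M. y" "\<lambda>y. y"] by (simp add: distr_id2)
  ultimately show ?thesis by (simp add: mp_action_def)
qed

lemma standard_prob_space_half:
  assumes "standard_prob_space M"
  obtains H where "H \<in> sets M" "measure M H = 1 / 2"
proof -
  let ?R = "restrict_space lborel {0..1::real}"
  obtain f where f: "f \<in> M \<rightarrow>\<^sub>M ?R" "distr M ?R f = ?R"
    using assms unfolding standard_prob_space_def by blast
  have half: "{0..1/2} \<in> sets ?R" by (auto simp: sets_restrict_space_iff)
  have "measure M (f -` {0..1/2} \<inter> space M) = measure ?R {0..1/2}"
    using measure_distr[OF f(1) half] unfolding f(2) ..
  also have "\<dots> = 1 / 2" by (subst measure_restrict_space) auto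
  finally show ?thesis using that measurable_sets[OF f(1) half] by blast
qed

theorem theorem2:
  fixes G :: "('g, 'm) monoid_scheme" and D :: "('d, 'n) monoid_scheme"
    and X :: "'x measure"
    and b0 :: "'g \<Rightarrow> 'x \<Rightarrow> 'x" and a0 :: "'d \<Rightarrow> 'x \<Rightarrow> 'x"
    and E F :: "'x rel"
    and N :: enat and C :: "nat \<Rightarrow> 'x \<Rightarrow> 'x"
  assumes "group G" and "countable (carrier G)"
    and "group D" and "countable (carrier D)"
    and "standard_prob_space X"
    and "mp_action G X b0" and "ergodic G X b0"
    and "mp_action D X a0" and "free_action D X a0"
    and F_def: "F = orbit_rel G X b0" and E_def: "E = orbit_rel D X a0"
    and "AE x in X. E `` {x} \<subseteq> F `` {x}"
    and "choice_functions X F E N C"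
    and "mixing G X b0"
    and type_y_hosts_standard_space: "\<exists>Y :: 'y measure. standard_prob_space Y"
  shows "(\<forall>(Y :: 'y measure) a. standard_prob_space Y \<and> mp_action D Y a \<longrightarrow>
            mixing G (coinduced_space X N Y) (coinduced G D X a0 b0 N C a))
         \<longleftrightarrow> (return_measure X E b0 \<longlongrightarrow> 0) (group_infinity G)"
proof -
  have setting: "coinduced_action G D X b0 a0 E F N C Y a"
    if "standard_prob_space Y" "mp_action D Y a" for Y :: "'y measure" and a
    using assms that
    by (auto simp: coinduced_action_def coinduced_action_axioms_def coinduction_def
        coinduction_axioms_def mp_action_def intro: standard_prob_space_imp_prob_space)
  show ?thesis
  proof
    assume mix: "\<forall>(Y :: 'y measure) a. standard_prob_space Y \<and> mp_action D Y a \<longrightarrow>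
      mixing G (coinduced_space X N Y) (coinduced G D X a0 b0 N C a)"
    obtain Y :: "'y measure" where Y: "standard_prob_space Y"
      using type_y_hosts_standard_space by blast
    obtain H where H: "H \<in> sets Y" "measure Y H = 1 / 2"
      using Y by (rule standard_prob_space_half)
    have triv: "mp_action D Y (\<lambda>_. \<lambda>y\<in>space Y. y)"
      using \<open>group D\<close> by (rule mp_action_trivial)
    interpret coinduced_action G D X b0 a0 E F N C Y "\<lambda>_. \<lambda>y\<in>space Y. y"
      using Y triv by (rule setting)
    show "(return_measure X E b0 \<longlongrightarrow> 0) (group_infinity G)"
      using mix Y triv H by (intro return_measure_tendsto_0[of H]) auto
  next
    assume lim: "(return_measure X E b0 \<longlongrightarrow> 0) (group_infinity G)"
    show "\<forall>(Y :: 'y measure) a. standard_prob_space Y \<and> mp_action D Y a \<longrightarrow>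
      mixing G (coinduced_space X N Y) (coinduced G D X a0 b0 N C a)"
      using coinduced_action.mixing_T[OF setting \<open>mixing G X b0\<close> lim] by blast
  qed
qed

end
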